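(* Let $(\mathcal{B},\mathbb{C},F,\mathbb{H})$ be a pre-geminal category, with associated endofunctor $\Box=\gamma_{\mathbb C}\circ F:\mathcal B\to\mathcal B$. For any object $A\in\mathcal{B}$ and any morphism $f:\Box A\to A$ in $\mathcal B$, there exists a global element $a:1\to A$ such that $f\circ Fa=a$, where $Fa:1\to\mathbb C(F1,FA)=\mathbb C(1_{\mathbb C},FA)=\Box A$ is the global element of $\Box A$ given by applying $F$ to $a$.
   Context: Internal categories. Let $\mathcal B$ be a locally small category with finite limits (a terminal object $1$ and pullbacks). A $\mathcal B$-internal category $\mathbb C$ has an object of objects $|\mathbb C|$, an object of morphisms $|\mathbb C^{\to}|$, morphisms $\mathrm{dom},\mathrm{cod}:|\mathbb C^\to|\to|\mathbb C|$, identities $e:|\mathbb C|\to|\mathbb C^\to|$ and a composition $\circ$ defined on the object of composable pairs (written in diagrammatic order), satisfying the usual axioms. An internal functor $\mathbb H:\mathbb C\to\mathbb D$ is a pair $|\mathbb H|:|\mathbb C|\to|\mathbb D|$, $|\mathbb H^\to|:|\mathbb C^\to|\to|\mathbb D^\to|$ commuting with this structure. A global element of $A$, written $a\in_1 A$, is a morphism $a:1\to A$. A global object $X\in_1\mathbb C$ is a morphism $X:1\to|\mathbb C|$; $\mathbb HX=|\mathbb H|\circ X$. The hom-object $\mathbb C(X,Y)$ is the pullback of $\langle\mathrm{dom},\mathrm{cod}\rangle:|\mathbb C^\to|\to|\mathbb C|\times|\mathbb C|$ along $\langle X,Y\rangle:1\to|\mathbb C|\times|\mathbb C|$; its global elements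 are identified with global elements of $|\mathbb C^\to|$ with domain $X$ and codomain $Y$. Composition induces $\circ_{\mathbb C}:\mathbb C(X,Y)\times\mathbb C(Y,Z)\to\mathbb C(X,Z)$. The underlying category $\Gamma\mathbb C$ has global objects as objects and global elements of $\mathbb C(X,Y)$ as morphisms $X\to Y$; an internal functor $\mathbb H$ induces a functor $\Gamma\mathbb H$. $\mathbb C$ has chosen finite limits if it is equipped with an internal chosen terminal object $1_{\mathbb C}\in_1\mathbb C$ and internal chosen pullbacks (given by morphisms of $\mathcal B$ expressing a choice of pullback squares and of mediating arrows, satisfying the evident internal equations); then $\Gamma\mathbb C$ has induced chosen finite limits. The global section functor is $\gamma_{\mathbb C}=\mathbb C(1_{\mathbb C},-):\Gamma\mathbb C\to\mathcal B$ (acting on morphisms by $\circ_{\mathbb C}$); it preserves finite limits. If $G:\mathcal B\to\mathcal B'$ preserves finite limits, $G\mathbb C$ is the $\mathcal B'$-internal category obtained by applying $G$ to all data of $\mathbb C$, and $G^{\#}_{\mathbb C}:\Gamma\mathbb C\to\Gamma G\mathbb C$ is the functor sending a global object $X$ to $1\cong G1\xrightarrow{GX}G|\mathbb C|$, and likewise on global morphisms. Pre-geminal category. It consists of: (I) a category $\mathcal B$ with chosen finite limits; (II) a $\mathcal B$-internal category $\mathbb C$ with chosen finite limits; (III) a functor $F:\mathcal B\to\Gamma\mathbb C$ strictly preserving the chosen finite limits; put $\Box=\gamma_{\mathbb C}\circ F:\mathcal B\to\mathcal B$, so $\Box A=\mathbb C(1_{\mathbb C},FA)$ (it preserves finite limits);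 (IV) a $\mathcal B$-internal functor $\mathbb H:\mathbb C\to\Box\mathbb C$ satisfying $\Gamma\mathbb H\circ F=F^{\#}_{\mathbb C}\circ F$, where the codomain $\Gamma F\mathbb C$ of $F^\#_{\mathbb C}$ is identified with $\Gamma\Box\mathbb C=\Gamma\gamma_{\mathbb C}F\mathbb C$ by the canonical isomorphism. Unfolded: with $u:1\cong\Box1$ the unique isomorphism, $|\mathbb H|\circ FA=\Box(FA)\circ u:1\to\Box|\mathbb C|$ for every object $A$ of $\mathcal B$, and $|\mathbb H^\to|\circ Ff=\Box(Ff)\circ u:1\to\Box|\mathbb C^\to|$ for every morphism $f$ of $\mathcal B$, where $FA:1\to|\mathbb C|$ and $Ff:1\to|\mathbb C^\to|$. *)

theory Defs
  imports Main
begin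

section \<open>Categories with chosen finite limits\<close>

text \<open>
  Composition is written in the usual order: \<open>g \<cdot> f\<close> is ``g after f''. Only values on the
  carriers \<open>Ob\<close> and \<open>Ar\<close> (and on composable arrows) are meaningful. Hom-collections are sets
  by construction, so local smallness needs no axiom.
\<close>

record ('o, 'm) cat =
  Ob :: "'o set"
  Ar :: "'m set"
  Dom :: "'m \<Rightarrow> 'o"
  Cod :: "'m \<Rightarrow> 'o"
  Idn :: "'o \<Rightarrow> 'm"
  Cmp :: "'m \<Rightarrow> 'm \<Rightarrow> 'm"  (infixl "\<cdot>\<index>" 70)

definition hom :: "('o, 'm, 'x) cat_scheme \<Rightarrow> 'o \<Rightarrow> 'o \<Rightarrow> 'm set" where
  "hom B X Y = {f \<in> Ar B. Dom B f = X \<and> Cod B f = Y}"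

locale category =
  fixes B :: "('o, 'm, 'x) cat_scheme" (structure)
  assumes Dom_in: "f \<in> Ar B \<Longrightarrow> Dom B f \<in> Ob B"
    and Cod_in: "f \<in> Ar B \<Longrightarrow> Cod B f \<in> Ob B"
    and Idn_in: "X \<in> Ob B \<Longrightarrow> Idn B X \<in> hom B X X"
    and Cmp_in: "f \<in> hom B X Y \<Longrightarrow> g \<in> hom B Y Z \<Longrightarrow> g \<cdot> f \<in> hom B X Z"
    and Cmp_Idn: "f \<in> hom B X Y \<Longrightarrow> f \<cdot> Idn B X = f"
    and Idn_Cmp: "f \<in> hom B X Y \<Longrightarrow> Idn B Y \<cdot> f = f"
    and Cmp_assoc: "f \<in> hom B W X \<Longrightarrow> g \<in> hom B X Y \<Longrightarrow> h \<in> hom B Y Z \<Longrightarrow>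
        (h \<cdot> g) \<cdot> f = h \<cdot> (g \<cdot> f)"

definition iso_in :: "('o, 'm, 'x) cat_scheme \<Rightarrow> 'm \<Rightarrow> 'o \<Rightarrow> 'o \<Rightarrow> bool" where
  "iso_in B f X Y \<longleftrightarrow> f \<in> hom B X Y \<and>
     (\<exists>g \<in> hom B Y X. g \<cdot>\<^bsub>B\<^esub> f = Idn B X \<and> f \<cdot>\<^bsub>B\<^esub> g = Idn B Y)"

definition is_terminal :: "('o, 'm, 'x) cat_scheme \<Rightarrow> 'o \<Rightarrow> bool" where
  "is_terminal B T \<longleftrightarrow> T \<in> Ob B \<and> (\<forall>X \<in> Ob B. \<exists>!t. t \<in> hom B X T)"

definition is_cospan :: "('o, 'm, 'x) cat_scheme \<Rightarrow> 'm \<Rightarrow> 'm \<Rightarrow> bool" where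
  "is_cospan B f g \<longleftrightarrow> f \<in> Ar B \<and> g \<in> Ar B \<and> Cod B f = Cod B g"

definition is_pullback :: "('o, 'm, 'x) cat_scheme \<Rightarrow> 'm \<Rightarrow> 'm \<Rightarrow> 'm \<Rightarrow> 'm \<Rightarrow> bool" where
  "is_pullback B f g p q \<longleftrightarrow>
     is_cospan B f g \<and>
     p \<in> hom B (Dom B p) (Dom B f) \<and> q \<in> hom B (Dom B p) (Dom B g) \<and>
     f \<cdot>\<^bsub>B\<^esub> p = g \<cdot>\<^bsub>B\<^esub> q \<and>
     (\<forall>T \<in> Ob B. \<forall>u \<in> hom B T (Dom B f). \<forall>v \<in> hom B T (Dom B g).
        f \<cdot>\<^bsub>B\<^esub> u = g \<cdot>\<^bsub>B\<^esub> v \<longrightarrow>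
        (\<exists>!w. w \<in> hom B T (Dom B p) \<and> p \<cdot>\<^bsub>B\<^esub> w = u \<and> q \<cdot>\<^bsub>B\<^esub> w = v))"

text \<open>The mediating arrow induced by \<open>u\<close>, \<open>v\<close> into the vertex of the limiting span \<open>(p, q)\<close>.\<close>

definition med :: "('o, 'm, 'x) cat_scheme \<Rightarrow> 'm \<Rightarrow> 'm \<Rightarrow> 'm \<Rightarrow> 'm \<Rightarrow> 'm" where
  "med B p q u v =
     (THE w. w \<in> hom B (Dom B u) (Dom B p) \<and> p \<cdot>\<^bsub>B\<^esub> w = u \<and> q \<cdot>\<^bsub>B\<^esub> w = v)"

text \<open>
  \<open>One\<close> is the chosen terminal object; \<open>Pr1 f g\<close> and \<open>Pr2 f g\<close> are the projections of the chosen
  pullback of a cospan \<open>f\<close>, \<open>g\<close>, whose vertex is their common domain.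
\<close>

record ('o, 'm) fcat = "('o, 'm) cat" +
  One :: 'o  ("\<one>\<index>")
  Pr1 :: "'m \<Rightarrow> 'm \<Rightarrow> 'm"
  Pr2 :: "'m \<Rightarrow> 'm \<Rightarrow> 'm"

locale finlim_category = category B
  for B :: "('o, 'm, 'x) fcat_scheme" (structure) +
  assumes One_terminal: "is_terminal B \<one>"
    and Pr_pullback: "is_cospan B f g \<Longrightarrow> is_pullback B f g (Pr1 B f g) (Pr2 B f g)"

abbreviation Pb :: "('o, 'm, 'x) fcat_scheme \<Rightarrow> 'm \<Rightarrow> 'm \<Rightarrow> 'o" where
  "Pb B f g \<equiv> Dom B (Pr1 B f g)"

text \<open>Mediating arrow into the chosen pullback of \<open>f\<close>, \<open>g\<close>.\<close>

definition pbmed :: "('o, 'm, 'x) fcat_scheme \<Rightarrow> 'm \<Rightarrow> 'm \<Rightarrow> 'm \<Rightarrow> 'm \<Rightarrow> 'm" where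
  "pbmed B f g u v = med B (Pr1 B f g) (Pr2 B f g) u v"

definition bang :: "('o, 'm, 'x) fcat_scheme \<Rightarrow> 'o \<Rightarrow> 'm" where
  "bang B X = (THE t. t \<in> hom B X \<one>\<^bsub>B\<^esub>)"

text \<open>
  The chosen product of \<open>X\<close> and \<open>Y\<close> is the chosen pullback over the terminal object;
  \<open>pairing B X Y u v\<close> is the arrow into it with components \<open>u\<close> and \<open>v\<close>.
\<close>

definition pairing :: "('o, 'm, 'x) fcat_scheme \<Rightarrow> 'o \<Rightarrow> 'o \<Rightarrow> 'm \<Rightarrow> 'm \<Rightarrow> 'm" where
  "pairing B X Y u v = pbmed B (bang B X) (bang B Y) u v"


section \<open>Functors\<close>

record ('o, 'm, 'p, 'n) fctr =
  omap :: "'o \<Rightarrow> 'p"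
  amap :: "'m \<Rightarrow> 'n"

definition is_functor ::
  "('o, 'm, 'x) cat_scheme \<Rightarrow> ('p, 'n, 'y) cat_scheme \<Rightarrow> ('o, 'm, 'p, 'n) fctr \<Rightarrow> bool" where
  "is_functor A B G \<longleftrightarrow>
     (\<forall>X \<in> Ob A. omap G X \<in> Ob B) \<and>
     (\<forall>f \<in> Ar A. amap G f \<in> hom B (omap G (Dom A f)) (omap G (Cod A f))) \<and>
     (\<forall>X \<in> Ob A. amap G (Idn A X) = Idn B (omap G X)) \<and>
     (\<forall>f \<in> Ar A. \<forall>g \<in> Ar A. Cod A f = Dom A g \<longrightarrow>
        amap G (g \<cdot>\<^bsub>A\<^esub> f) = amap G g \<cdot>\<^bsub>B\<^esub> amap G f)"

definition strictly_preserves_finlims ::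
  "('o, 'm, 'x) fcat_scheme \<Rightarrow> ('p, 'n, 'y) fcat_scheme \<Rightarrow> ('o, 'm, 'p, 'n) fctr \<Rightarrow> bool" where
  "strictly_preserves_finlims A B G \<longleftrightarrow>
     omap G \<one>\<^bsub>A\<^esub> = \<one>\<^bsub>B\<^esub> \<and>
     (\<forall>f g. is_cospan A f g \<longrightarrow>
        omap G (Pb A f g) = Pb B (amap G f) (amap G g) \<and>
        amap G (Pr1 A f g) = Pr1 B (amap G f) (amap G g) \<and>
        amap G (Pr2 A f g) = Pr2 B (amap G f) (amap G g))"

definition fcomp ::
  "('p, 'n, 'q, 'k) fctr \<Rightarrow> ('o, 'm, 'p, 'n) fctr \<Rightarrow> ('o, 'm, 'q, 'k) fctr" where
  "fcomp G F = \<lparr>omap = \<lambda>X. omap G (omap F X), amap = \<lambda>f. amap G (amap F f)\<rparr>"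


section \<open>Internal categories\<close>

text \<open>
  The object of composable pairs is carried along as a limiting span \<open>(cp1, cp2)\<close> with vertex
  \<open>icomps\<close>, so that a functor preserving finite limits can be applied literally to all the data.
  Internal composition is in diagrammatic order: on composable pairs \<open>(f, g)\<close> with
  \<open>icod f = idom g\<close>, it is ``first \<open>f\<close>, then \<open>g\<close>''.
\<close>

record ('o, 'm) icat =
  iobj :: 'o
  iarr :: 'o
  icomps :: 'o
  idom :: 'm
  icod :: 'm
  iid :: 'm
  cp1 :: 'm
  cp2 :: 'm
  icmp :: 'm

text \<open>The internal composite of generalised elements \<open>u\<close>, \<open>v\<close> of the object of morphisms.\<close>

definition ic ::
  "('o, 'm, 'x) cat_scheme \<Rightarrow> ('o, 'm, 'y) icat_scheme \<Rightarrow> 'm \<Rightarrow> 'm \<Rightarrow> 'm" where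
  "ic B C u v = icmp C \<cdot>\<^bsub>B\<^esub> med B (cp1 C) (cp2 C) u v"

text \<open>In \<open>assoc\<close> the object of composable triples is the pullback of \<open>cp2\<close> and \<open>cp1\<close>.\<close>

locale internal_category =
  fixes B :: "('o, 'm, 'x) fcat_scheme" (structure)
    and C :: "('o, 'm, 'y) icat_scheme"
  assumes iobj_in: "iobj C \<in> Ob B"
    and iarr_in: "iarr C \<in> Ob B"
    and idom_in: "idom C \<in> hom B (iarr C) (iobj C)"
    and icod_in: "icod C \<in> hom B (iarr C) (iobj C)"
    and iid_in: "iid C \<in> hom B (iobj C) (iarr C)"
    and cp1_in: "cp1 C \<in> hom B (icomps C) (iarr C)"
    and cp2_in: "cp2 C \<in> hom B (icomps C) (iarr C)"
    and comps_pullback: "is_pullback B (icod C) (idom C) (cp1 C) (cp2 C)"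
    and icmp_in: "icmp C \<in> hom B (icomps C) (iarr C)"
    and dom_id: "idom C \<cdot> iid C = Idn B (iobj C)"
    and cod_id: "icod C \<cdot> iid C = Idn B (iobj C)"
    and dom_cmp: "idom C \<cdot> icmp C = idom C \<cdot> cp1 C"
    and cod_cmp: "icod C \<cdot> icmp C = icod C \<cdot> cp2 C"
    and id_left: "ic B C (iid C \<cdot> idom C) (Idn B (iarr C)) = Idn B (iarr C)"
    and id_right: "ic B C (Idn B (iarr C)) (iid C \<cdot> icod C) = Idn B (iarr C)"
    and assoc:
      "let q = Pr1 B (cp2 C) (cp1 C); r = Pr2 B (cp2 C) (cp1 C)
       in ic B C (icmp C \<cdot> q) (cp2 C \<cdot> r) = ic B C (cp1 C \<cdot> q) (icmp C \<cdot> r)"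

record 'm ifctr =
  iomap :: 'm
  iamap :: 'm

definition is_internal_functor ::
  "('o, 'm, 'x) cat_scheme \<Rightarrow> ('o, 'm, 'y) icat_scheme \<Rightarrow> ('o, 'm, 'z) icat_scheme \<Rightarrow>
     'm ifctr \<Rightarrow> bool" where
  "is_internal_functor B C D H \<longleftrightarrow>
     iomap H \<in> hom B (iobj C) (iobj D) \<and>
     iamap H \<in> hom B (iarr C) (iarr D) \<and>
     idom D \<cdot>\<^bsub>B\<^esub> iamap H = iomap H \<cdot>\<^bsub>B\<^esub> idom C \<and>
     icod D \<cdot>\<^bsub>B\<^esub> iamap H = iomap H \<cdot>\<^bsub>B\<^esub> icod C \<and>
     iamap H \<cdot>\<^bsub>B\<^esub> iid C = iid D \<cdot>\<^bsub>B\<^esub> iomap H \<and>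
     iamap H \<cdot>\<^bsub>B\<^esub> icmp C = ic B D (iamap H \<cdot>\<^bsub>B\<^esub> cp1 C) (iamap H \<cdot>\<^bsub>B\<^esub> cp2 C)"

definition apply_icat ::
  "('o, 'm, 'p, 'n) fctr \<Rightarrow> ('o, 'm, 'y) icat_scheme \<Rightarrow> ('p, 'n) icat" where
  "apply_icat G C =
     \<lparr>iobj = omap G (iobj C), iarr = omap G (iarr C), icomps = omap G (icomps C),
      idom = amap G (idom C), icod = amap G (icod C), iid = amap G (iid C),
      cp1 = amap G (cp1 C), cp2 = amap G (cp2 C), icmp = amap G (icmp C)\<rparr>"


section \<open>Internal chosen finite limits\<close>

text \<open>
  \<open>ione\<close> is the internal terminal object and \<open>ibang\<close> assigns to each object its arrow to \<open>ione\<close>.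
  \<open>ipl\<close>, \<open>ipr\<close> are defined on the object of internal cospans (the pullback of \<open>icod\<close> with itself)
  and give the two projections of the chosen pullback. \<open>imed\<close> is defined on the object of internal
  commutative squares, i.e. the pullback of \<open>icmp\<close> with itself: pairs of composable pairs
  \<open>((h, f), (k, g))\<close> with the same composite; it gives the mediating arrow induced by \<open>h\<close>, \<open>k\<close>
  into the chosen pullback of the cospan \<open>(f, g)\<close>.
\<close>

record ('o, 'm) ificat = "('o, 'm) icat" +
  ione :: 'm
  ibang :: 'm
  ipl :: 'm
  ipr :: 'm
  imed :: 'm

text \<open>
  The uniqueness axioms are equations on universal objects: \<open>ibang_unique\<close> on the object of arrows
  with codomain \<open>ione\<close>, and \<open>imed_unique\<close> on the object of pairs of a cospan \<open>c\<close> and an arrow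
  \<open>m\<close> into the vertex of its chosen pullback.
\<close>

locale internal_finlim_category = internal_category B C
  for B :: "('o, 'm, 'x) fcat_scheme" (structure)
    and C :: "('o, 'm, 'y) ificat_scheme" +
  assumes ione_in: "ione C \<in> hom B \<one> (iobj C)"
    and ibang_in: "ibang C \<in> hom B (iobj C) (iarr C)"
    and dom_ibang: "idom C \<cdot> ibang C = Idn B (iobj C)"
    and cod_ibang: "icod C \<cdot> ibang C = ione C \<cdot> bang B (iobj C)"
    and ibang_unique:
      "let q = Pr1 B (icod C) (ione C) in ibang C \<cdot> (idom C \<cdot> q) = q"
    and ipl_in: "ipl C \<in> hom B (Pb B (icod C) (icod C)) (iarr C)"
    and ipr_in: "ipr C \<in> hom B (Pb B (icod C) (icod C)) (iarr C)"
    and dom_ipl_ipr: "idom C \<cdot> ipl C = idom C \<cdot> ipr C"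
    and cod_ipl: "icod C \<cdot> ipl C = idom C \<cdot> Pr1 B (icod C) (icod C)"
    and cod_ipr: "icod C \<cdot> ipr C = idom C \<cdot> Pr2 B (icod C) (icod C)"
    and ipb_commutes:
      "ic B C (ipl C) (Pr1 B (icod C) (icod C)) = ic B C (ipr C) (Pr2 B (icod C) (icod C))"
    and imed_in: "imed C \<in> hom B (Pb B (icmp C) (icmp C)) (iarr C)"
    and imed_mediates:
      "let s = Pr1 B (icmp C) (icmp C); t = Pr2 B (icmp C) (icmp C);
           h = cp1 C \<cdot> s; f = cp2 C \<cdot> s; k = cp1 C \<cdot> t; g = cp2 C \<cdot> t;
           c = pbmed B (icod C) (icod C) f g
       in idom C \<cdot> imed C = idom C \<cdot> h \<and>
          icod C \<cdot> imed C = idom C \<cdot> (ipl C \<cdot> c) \<and>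
          ic B C (imed C) (ipl C \<cdot> c) = h \<and>
          ic B C (imed C) (ipr C \<cdot> c) = k"
    and imed_unique:
      "let m = Pr1 B (icod C) (idom C \<cdot> ipl C); c = Pr2 B (icod C) (idom C \<cdot> ipl C);
           f = Pr1 B (icod C) (icod C) \<cdot> c; g = Pr2 B (icod C) (icod C) \<cdot> c;
           h = ic B C m (ipl C \<cdot> c); k = ic B C m (ipr C \<cdot> c)
       in imed C \<cdot> pbmed B (icmp C) (icmp C)
            (med B (cp1 C) (cp2 C) h f) (med B (cp1 C) (cp2 C) k g) = m"


section \<open>Underlying category, hom-objects and global sections\<close>

text \<open>
  Objects of the underlying category are global elements of the object of objects, arrows are
  global elements of the object of morphisms. \<open>Cmp g f\<close> (``g after f'') is the internal
  diagrammatic composite of \<open>f\<close> and \<open>g\<close>.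
\<close>

definition Gam ::
  "('o, 'm, 'x) fcat_scheme \<Rightarrow> ('o, 'm, 'y) ificat_scheme \<Rightarrow> ('m, 'm) fcat" where
  "Gam B C =
     \<lparr>Ob = hom B \<one>\<^bsub>B\<^esub> (iobj C), Ar = hom B \<one>\<^bsub>B\<^esub> (iarr C),
      Dom = \<lambda>f. idom C \<cdot>\<^bsub>B\<^esub> f, Cod = \<lambda>f. icod C \<cdot>\<^bsub>B\<^esub> f,
      Idn = \<lambda>X. iid C \<cdot>\<^bsub>B\<^esub> X, Cmp = \<lambda>g f. ic B C f g,
      One = ione C,
      Pr1 = \<lambda>f g. ipl C \<cdot>\<^bsub>B\<^esub> pbmed B (icod C) (icod C) f g,
      Pr2 = \<lambda>f g. ipr C \<cdot>\<^bsub>B\<^esub> pbmed B (icod C) (icod C) f g\<rparr>"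

definition domcod :: "('o, 'm, 'x) fcat_scheme \<Rightarrow> ('o, 'm, 'y) icat_scheme \<Rightarrow> 'm" where
  "domcod B C = pairing B (iobj C) (iobj C) (idom C) (icod C)"

text \<open>\<open>hom_incl B C X Y\<close> is the projection from the hom-object to the object of morphisms.\<close>

definition hom_incl ::
  "('o, 'm, 'x) fcat_scheme \<Rightarrow> ('o, 'm, 'y) icat_scheme \<Rightarrow> 'm \<Rightarrow> 'm \<Rightarrow> 'm" where
  "hom_incl B C X Y = Pr1 B (domcod B C) (pairing B (iobj C) (iobj C) X Y)"

definition hom_obj ::
  "('o, 'm, 'x) fcat_scheme \<Rightarrow> ('o, 'm, 'y) icat_scheme \<Rightarrow> 'm \<Rightarrow> 'm \<Rightarrow> 'o" where
  "hom_obj B C X Y = Pb B (domcod B C) (pairing B (iobj C) (iobj C) X Y)"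

text \<open>
  \<open>hom_elt B C X Y u\<close> is the factorisation through the hom-object of a (generalised) element
  \<open>u\<close> of the object of morphisms whose domain is \<open>X\<close> and whose codomain is \<open>Y\<close>.
\<close>

definition hom_elt ::
  "('o, 'm, 'x) fcat_scheme \<Rightarrow> ('o, 'm, 'y) icat_scheme \<Rightarrow> 'm \<Rightarrow> 'm \<Rightarrow> 'm \<Rightarrow> 'm" where
  "hom_elt B C X Y u =
     pbmed B (domcod B C) (pairing B (iobj C) (iobj C) X Y) u (bang B (Dom B u))"

text \<open>
  On a global arrow \<open>g : X \<rightarrow> Y\<close> the global section functor is postcomposition with \<open>g\<close>, computed
  on the generic element \<open>hom_incl\<close> of the hom-object from \<open>ione\<close> to \<open>X\<close>.
\<close>

definition gsec ::
  "('o, 'm, 'x) fcat_scheme \<Rightarrow> ('o, 'm, 'y) ificat_scheme \<Rightarrow> ('m, 'm, 'o, 'm) fctr" where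
  "gsec B C =
     \<lparr>omap = \<lambda>X. hom_obj B C (ione C) X,
      amap = \<lambda>g. let X = idom C \<cdot>\<^bsub>B\<^esub> g; Y = icod C \<cdot>\<^bsub>B\<^esub> g
        in hom_elt B C (ione C) Y
             (ic B C (hom_incl B C (ione C) X)
                     (g \<cdot>\<^bsub>B\<^esub> bang B (hom_obj B C (ione C) X)))\<rparr>"


section \<open>Pre-geminal categories\<close>

definition Box ::
  "('o, 'm, 'x) fcat_scheme \<Rightarrow> ('o, 'm, 'y) ificat_scheme \<Rightarrow> ('o, 'm, 'm, 'm) fctr \<Rightarrow>
     ('o, 'm, 'o, 'm) fctr" where
  "Box B C F = fcomp (gsec B C) F"

text \<open>
  The image under an endofunctor \<open>G\<close> (with \<open>G 1\<close> terminal) of a global element \<open>x\<close>, as a global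
  element again: \<open>1 \<cong> G 1 \<rightarrow> G X\<close>.
\<close>

definition sharp :: "('o, 'm, 'x) fcat_scheme \<Rightarrow> ('o, 'm, 'o, 'm) fctr \<Rightarrow> 'm \<Rightarrow> 'm" where
  "sharp B G x = amap G x \<cdot>\<^bsub>B\<^esub> (THE u. iso_in B u \<one>\<^bsub>B\<^esub> (omap G \<one>\<^bsub>B\<^esub>))"

locale pregeminal =
  fixes B :: "('o, 'm, 'x) fcat_scheme" (structure)
    and C :: "('o, 'm, 'y) ificat_scheme"
    and F :: "('o, 'm, 'm, 'm) fctr"
    and H :: "'m ifctr"
  assumes finlim_B: "finlim_category B"
    and finlim_C: "internal_finlim_category B C"
    and functor_F: "is_functor B (Gam B C) F"
    and strict_F: "strictly_preserves_finlims B (Gam B C) F"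
    and functor_H: "is_internal_functor B C (apply_icat (Box B C F) C) H"
    and H_obj: "X \<in> Ob B \<Longrightarrow> iomap H \<cdot> omap F X = sharp B (Box B C F) (omap F X)"
    and H_arr: "f \<in> Ar B \<Longrightarrow> iamap H \<cdot> amap F f = sharp B (Box B C F) (amap F f)"

end

theory Submission
  imports Defs
begin

text \<open>
  A diagonal argument. An arrow \<open>x : p \<rightarrow> F (iarr C)\<close> of \<open>C\<close> is a family of \<open>C\<close>-objects indexed by
  codes of arrows, and \<open>H\<close> sends \<open>x\<close> to its own code \<open>quote x : 1 \<rightarrow> F (iarr C)\<close>; let \<open>diag x\<close> be
  the fibre of the family \<open>x\<close> over \<open>quote x\<close>. Applying this to the \<open>F\<close>-image of the object of
  all \<open>y : diag x \<rightarrow> F A\<close> over varying \<open>x\<close> gives an object \<open>D\<close> of \<open>B\<close> that consists precisely of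
  the arrows \<open>F D \<rightarrow> F A\<close> of \<open>C\<close>. Now \<open>H\<close> sends \<open>y \<in> D\<close> to a code \<open>\<delta> y : 1 \<rightarrow> F D\<close>, and composing
  it with \<open>y\<close> itself gives a self-application \<open>ev : D \<rightarrow> \<box> A\<close>. If \<open>t \<in> D\<close> is the global element
  \<open>F (f \<cdot> ev)\<close>, then \<open>\<delta> t = F t\<close>, and \<open>a = f \<cdot> (ev \<cdot> t)\<close> is the fixed point.

  The constructions inside \<open>C\<close> are carried out with generalised elements: for each object \<open>T\<close> of
  \<open>B\<close>, the arrows from \<open>T\<close> to \<open>iobj C\<close> and \<open>iarr C\<close> form an ordinary category \<open>stage B C T\<close> with
  chosen finite limits, and \<open>F\<close> followed by reindexing along \<open>T \<rightarrow> 1\<close> is a strict functor into it.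
\<close>

subsection \<open>Categories and chosen pullbacks\<close>

context category
begin

lemma in_hom_iff: "f \<in> hom B X Y \<longleftrightarrow> f \<in> Ar B \<and> Dom B f = X \<and> Cod B f = Y"
  by (simp add: hom_def)

lemma Dom_Ob [simp]: "f \<in> Ar B \<Longrightarrow> Dom B f \<in> Ob B"
  and Cod_Ob [simp]: "f \<in> Ar B \<Longrightarrow> Cod B f \<in> Ob B"
  by (fact Dom_in Cod_in)+

lemma Idn_simps [simp]:
  assumes "X \<in> Ob B"
  shows "Idn B X \<in> Ar B" "Dom B (Idn B X) = X" "Cod B (Idn B X) = X"
  using Idn_in[OF assms] by (simp_all add: in_hom_iff)

lemma Cmp_simps [simp]:
  assumes "f \<in> Ar B" "g \<in> Ar B" "Cod B f = Dom B g"
  shows "g \<cdot> f \<in> Ar B" "Dom B (g \<cdot> f) = Dom B f" "Cod B (g \<cdot> f) = Cod B g"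
  using Cmp_in[of f "Dom B f" "Cod B f" g "Cod B g"] assms by (simp_all add: in_hom_iff)

lemma Cmp_Idn_simps [simp]:
  assumes "f \<in> Ar B"
  shows "Dom B f = X \<Longrightarrow> f \<cdot> Idn B X = f" "Cod B f = X \<Longrightarrow> Idn B X \<cdot> f = f"
  using assms by (auto intro: Cmp_Idn Idn_Cmp simp: in_hom_iff)

lemma Cmp_assoc_simp [simp]:
  assumes "f \<in> Ar B" "g \<in> Ar B" "h \<in> Ar B" "Cod B f = Dom B g" "Cod B g = Dom B h"
  shows "(h \<cdot> g) \<cdot> f = h \<cdot> (g \<cdot> f)"
  using assms by (auto intro: Cmp_assoc simp: in_hom_iff)

text \<open>Composites are kept nested to the right by \<open>Cmp_assoc_simp\<close>, so an equation
  between two-fold composites stops matching once an arrow \<open>t\<close> is precomposed; this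
  form restores it.\<close>

lemma Cmp_extend:
  assumes "g \<cdot> f = k \<cdot> h" "f \<in> Ar B" "g \<in> Ar B" "h \<in> Ar B" "k \<in> Ar B"
    "Cod B f = Dom B g" "Cod B h = Dom B k" "t \<in> Ar B" "Cod B t = Dom B f" "Cod B t = Dom B h"
  shows "g \<cdot> (f \<cdot> t) = k \<cdot> (h \<cdot> t)"
  using assms by (metis Cmp_assoc_simp)

lemma Cmp_extend1:
  assumes "g \<cdot> f = k" "f \<in> Ar B" "g \<in> Ar B" 
    "Cod B f = Dom B g" "t \<in> Ar B" "Cod B t = Dom B f"
  shows "g \<cdot> (f \<cdot> t) = k \<cdot> t"
  using assms by (metis Cmp_assoc_simp)

lemma pullbackD:
  assumes "is_pullback B f g p q"
  shows "f \<in> Ar B" "g \<in> Ar B" "Cod B g = Cod B f" "p \<in> Ar B" "q \<in> Ar B"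
    "Dom B q = Dom B p" "Cod B p = Dom B f" "Cod B q = Dom B g" "f \<cdot> p = g \<cdot> q"
  using assms by (auto simp: is_pullback_def is_cospan_def hom_def)

lemma pullback_eqI:
  assumes pb: "is_pullback B f g p q"
    and w: "w \<in> Ar B" "w' \<in> Ar B" "Cod B w = Dom B p" "Cod B w' = Dom B p" "Dom B w = Dom B w'"
    and eq: "p \<cdot> w = p \<cdot> w'" "q \<cdot> w = q \<cdot> w'"
  shows "w = w'"
proof -
  note pbs = pullbackD[OF pb]
  have "f \<cdot> (p \<cdot> w') = g \<cdot> (q \<cdot> w')"
    using pbs w by (intro Cmp_extend) auto
  moreover have "p \<cdot> w' \<in> hom B (Dom B w') (Dom B f)" "q \<cdot> w' \<in> hom B (Dom B w') (Dom B g)"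
    using pbs w by (auto simp: in_hom_iff)
  ultimately have "\<exists>!v. v \<in> hom B (Dom B w') (Dom B p) \<and> p \<cdot> v = p \<cdot> w' \<and> q \<cdot> v = q \<cdot> w'"
    using pb w unfolding is_pullback_def by auto
  then show ?thesis
    using w eq by (auto simp: in_hom_iff)
qed

lemma med_simps:
  assumes pb: "is_pullback B f g p q"
    and uv: "u \<in> Ar B" "v \<in> Ar B" "Dom B u = Dom B v" "Cod B u = Dom B f" "Cod B v = Dom B g"
      "f \<cdot> u = g \<cdot> v"
  shows "med B p q u v \<in> Ar B" "Dom B (med B p q u v) = Dom B v"
    "Cod B (med B p q u v) = Dom B p" "p \<cdot> med B p q u v = u" "q \<cdot> med B p q u v = v"
proof -
  have "\<exists>!w. w \<in> hom B (Dom B u) (Dom B p) \<and> p \<cdot> w = u \<and> q \<cdot> w = v"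
    using pb uv unfolding is_pullback_def by (auto simp: in_hom_iff)
  from theI'[OF this] show "med B p q u v \<in> Ar B" "Dom B (med B p q u v) = Dom B v"
    "Cod B (med B p q u v) = Dom B p" "p \<cdot> med B p q u v = u" "q \<cdot> med B p q u v = v"
    using uv by (simp_all add: med_def in_hom_iff)
qed

lemma med_eqI:
  assumes pb: "is_pullback B f g p q"
    and w: "w \<in> Ar B" "Cod B w = Dom B p" "p \<cdot> w = u" "q \<cdot> w = v"
  shows "med B p q u v = w"
proof -
  note pbs = pullbackD[OF pb]
  have uv: "u \<in> Ar B" "v \<in> Ar B" "Dom B u = Dom B w" "Dom B v = Dom B w"
      "Cod B u = Dom B f" "Cod B v = Dom B g" "f \<cdot> u = g \<cdot> v"
    using w pbs Cmp_extend[of f p g q w] by auto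
  show ?thesis
    by (rule pullback_eqI[OF pb]) (use uv w med_simps[OF pb, of u v] in auto)
qed

text \<open>Both sides have the same projections. This naturality lets operations defined through
  mediating arrows commute with precomposition.\<close>

lemma med_Cmp:
  assumes pb: "is_pullback B f g p q"
    and uv: "u \<in> Ar B" "v \<in> Ar B" "Dom B u = Dom B v" "Cod B u = Dom B f" "Cod B v = Dom B g"
      "f \<cdot> u = g \<cdot> v"
    and t: "t \<in> Ar B" "Cod B t = Dom B v"
  shows "med B p q u v \<cdot> t = med B p q (u \<cdot> t) (v \<cdot> t)"
proof -
  note m = med_simps[OF pb uv] and pbs = pullbackD[OF pb]
  show ?thesis
    by (rule sym, rule med_eqI[OF pb]) (use m pbs t uv in \<open>auto simp: Cmp_extend1\<close>)
qed

end

section \<open>The chosen terminal object, pullbacks and products\<close>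

context finlim_category
begin

lemma One_Ob [simp]: "\<one> \<in> Ob B"
  using One_terminal by (simp add: is_terminal_def)

lemma bang_simps [simp]:
  assumes "X \<in> Ob B"
  shows "bang B X \<in> Ar B" "Dom B (bang B X) = X" "Cod B (bang B X) = \<one>"
proof -
  have "\<exists>!t. t \<in> hom B X \<one>"
    using One_terminal assms by (simp add: is_terminal_def)
  from theI'[OF this] show "bang B X \<in> Ar B" "Dom B (bang B X) = X" "Cod B (bang B X) = \<one>"
    by (simp_all add: bang_def in_hom_iff)
qed

lemma bang_eqI: "t \<in> Ar B \<Longrightarrow> Cod B t = \<one> \<Longrightarrow> t = bang B (Dom B t)"
  using One_terminal bang_simps[of "Dom B t"] unfolding is_terminal_def in_hom_iff
  by (metis Dom_Ob)

lemma bang_Cmp [simp]: "t \<in> Ar B \<Longrightarrow> Cod B t = X \<Longrightarrow> bang B X \<cdot> t = bang B (Dom B t)"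
  using bang_eqI[of "bang B X \<cdot> t"] by auto

lemma bang_One [simp]: "bang B \<one> = Idn B \<one>"
  using bang_eqI[of "Idn B \<one>"] by simp

context
  fixes f g
  assumes fg: "f \<in> Ar B" "g \<in> Ar B" "Cod B f = Cod B g"
begin

lemma chosen_pullback: "is_pullback B f g (Pr1 B f g) (Pr2 B f g)"
  using fg by (intro Pr_pullback) (simp add: is_cospan_def)

lemma Pr_simps [simp]:
  "Pr1 B f g \<in> Ar B" "Pr2 B f g \<in> Ar B" "Cod B (Pr1 B f g) = Dom B f"
  "Cod B (Pr2 B f g) = Dom B g" "Dom B (Pr2 B f g) = Dom B (Pr1 B f g)"
  using pullbackD[OF chosen_pullback] by auto

lemma Pr_commute: "f \<cdot> Pr1 B f g = g \<cdot> Pr2 B f g"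
  using pullbackD[OF chosen_pullback] by auto

lemmas pbmed_simps = med_simps[OF chosen_pullback, folded pbmed_def]
lemmas pbmed_Cmp = med_Cmp[OF chosen_pullback, folded pbmed_def]
lemmas Pr_eqI = pullback_eqI[OF chosen_pullback]

end

lemma pairing_simps:
  assumes "u \<in> Ar B" "v \<in> Ar B" "Dom B u = Dom B v" "Cod B u = X" "Cod B v = Y"
  shows "pairing B X Y u v \<in> Ar B" "Dom B (pairing B X Y u v) = Dom B v"
    "Cod B (pairing B X Y u v) = Pb B (bang B X) (bang B Y)"
    "Pr1 B (bang B X) (bang B Y) \<cdot> pairing B X Y u v = u"
    "Pr2 B (bang B X) (bang B Y) \<cdot> pairing B X Y u v = v"
  unfolding pairing_def using assms by (auto intro!: pbmed_simps)

lemma pairing_Cmp: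
  assumes "u \<in> Ar B" "v \<in> Ar B" "Dom B u = Dom B v" "Cod B u = X" "Cod B v = Y"
    "t \<in> Ar B" "Cod B t = Dom B v"
  shows "pairing B X Y u v \<cdot> t = pairing B X Y (u \<cdot> t) (v \<cdot> t)"
  unfolding pairing_def using assms by (intro pbmed_Cmp) auto

end

lemma is_functorD:
  assumes "is_functor A B G"
  shows "X \<in> Ob A \<Longrightarrow> omap G X \<in> Ob B"
    "f \<in> Ar A \<Longrightarrow> amap G f \<in> Ar B"
    "f \<in> Ar A \<Longrightarrow> Dom B (amap G f) = omap G (Dom A f)"
    "f \<in> Ar A \<Longrightarrow> Cod B (amap G f) = omap G (Cod A f)"
    "X \<in> Ob A \<Longrightarrow> amap G (Idn A X) = Idn B (omap G X)"
    "f \<in> Ar A \<Longrightarrow> g \<in> Ar A \<Longrightarrow> Cod A f = Dom A g \<Longrightarrow>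
       amap G (g \<cdot>\<^bsub>A\<^esub> f) = amap G g \<cdot>\<^bsub>B\<^esub> amap G f"
  using assms by (auto simp: is_functor_def hom_def)

subsection \<open>Generalised elements of an internal category\<close>

text \<open>Only the carriers and the terminal object of \<open>Gam\<close> refer to the domain of
  the elements; the other operations are composites in \<open>B\<close> and serve generalised
  elements verbatim.\<close>

definition stage ::
  "('o, 'm, 'x) fcat_scheme \<Rightarrow> ('o, 'm, 'y) ificat_scheme \<Rightarrow> 'o \<Rightarrow> ('m, 'm) fcat" where
  "stage B C T = Gam B C
     \<lparr>Ob := hom B T (iobj C), Ar := hom B T (iarr C), One := ione C \<cdot>\<^bsub>B\<^esub> bang B T\<rparr>"

locale internal_cat = finlim_category B + internal_category B C
  for B :: "('o, 'm, 'x) fcat_scheme" (structure) and C :: "('o, 'm, 'y) icat_scheme"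
begin

lemma structure_simps [simp]:
  "iobj C \<in> Ob B" "iarr C \<in> Ob B"
  "idom C \<in> Ar B" "Dom B (idom C) = iarr C" "Cod B (idom C) = iobj C"
  "icod C \<in> Ar B" "Dom B (icod C) = iarr C" "Cod B (icod C) = iobj C"
  "iid C \<in> Ar B" "Dom B (iid C) = iobj C" "Cod B (iid C) = iarr C"
  "cp1 C \<in> Ar B" "Dom B (cp1 C) = icomps C" "Cod B (cp1 C) = iarr C"
  "cp2 C \<in> Ar B" "Dom B (cp2 C) = icomps C" "Cod B (cp2 C) = iarr C"
  "icmp C \<in> Ar B" "Dom B (icmp C) = icomps C" "Cod B (icmp C) = iarr C"
  using iobj_in iarr_in idom_in icod_in iid_in cp1_in cp2_in icmp_in by (auto simp: in_hom_iff)

lemma dom_cod_iid [simp]: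
  assumes "x \<in> Ar B" "Cod B x = iobj C"
  shows "idom C \<cdot> (iid C \<cdot> x) = x" "icod C \<cdot> (iid C \<cdot> x) = x"
  using assms Cmp_extend1[OF dom_id] Cmp_extend1[OF cod_id] by auto

lemma comp_pair_simps:
  assumes "u \<in> Ar B" "v \<in> Ar B" "Dom B u = Dom B v" "Cod B u = iarr C" "Cod B v = iarr C"
    "icod C \<cdot> u = idom C \<cdot> v"
  shows "med B (cp1 C) (cp2 C) u v \<in> Ar B" "Dom B (med B (cp1 C) (cp2 C) u v) = Dom B v"
    "Cod B (med B (cp1 C) (cp2 C) u v) = icomps C" "cp1 C \<cdot> med B (cp1 C) (cp2 C) u v = u"
    "cp2 C \<cdot> med B (cp1 C) (cp2 C) u v = v"
  using assms med_simps[OF comps_pullback, of u v] by auto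

lemma comp_pair_Cmp:
  assumes "u \<in> Ar B" "v \<in> Ar B" "Dom B u = Dom B v" "Cod B u = iarr C" "Cod B v = iarr C"
    "icod C \<cdot> u = idom C \<cdot> v" "t \<in> Ar B" "Cod B t = Dom B v"
  shows "med B (cp1 C) (cp2 C) u v \<cdot> t = med B (cp1 C) (cp2 C) (u \<cdot> t) (v \<cdot> t)"
  using assms by (intro med_Cmp[OF comps_pullback]) auto

lemma ic_simps:
  assumes "u \<in> Ar B" "v \<in> Ar B" "Dom B u = Dom B v" "Cod B u = iarr C" "Cod B v = iarr C"
    "icod C \<cdot> u = idom C \<cdot> v"
  shows "ic B C u v \<in> Ar B" "Dom B (ic B C u v) = Dom B v" "Cod B (ic B C u v) = iarr C"
    "idom C \<cdot> ic B C u v = idom C \<cdot> u" "icod C \<cdot> ic B C u v = icod C \<cdot> v"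
  unfolding ic_def using comp_pair_simps[OF assms]
    Cmp_extend[OF dom_cmp, of "med B (cp1 C) (cp2 C) u v"]
    Cmp_extend[OF cod_cmp, of "med B (cp1 C) (cp2 C) u v"] by auto

lemma ic_Cmp:
  assumes "u \<in> Ar B" "v \<in> Ar B" "Dom B u = Dom B v" "Cod B u = iarr C" "Cod B v = iarr C"
    "icod C \<cdot> u = idom C \<cdot> v" "t \<in> Ar B" "Cod B t = Dom B v"
  shows "ic B C u v \<cdot> t = ic B C (u \<cdot> t) (v \<cdot> t)"
  unfolding ic_def using comp_pair_simps[OF assms(1-6)] assms(7,8) comp_pair_Cmp[OF assms] by auto

text \<open>The axiom \<open>id_left\<close> is the case of the generic arrow, the identity of
  \<open>iarr C\<close>; precomposing with \<open>u\<close> gives the rest. The separate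
  \<open>X\<close> lets the rule fire after the domain of \<open>u\<close> has been
  rewritten.\<close>

lemma ic_iid_left [simp]:
  assumes "u \<in> Ar B" "Cod B u = iarr C" "X = idom C \<cdot> u"
  shows "ic B C (iid C \<cdot> X) u = u"
  using arg_cong[OF id_left, of "\<lambda>x. x \<cdot> u"] assms by (simp add: ic_Cmp)

lemma ic_iid_right [simp]:
  assumes "u \<in> Ar B" "Cod B u = iarr C" "X = icod C \<cdot> u"
  shows "ic B C u (iid C \<cdot> X) = u"
  using arg_cong[OF id_right, of "\<lambda>x. x \<cdot> u"] assms by (simp add: ic_Cmp)

text \<open>The axiom \<open>assoc\<close> speaks of the generic composable triple; it is
  precomposed with the arrow \<open>?t\<close> that classifies \<open>u\<close>, \<open>v\<close>,
  \<open>w\<close> as the pairs \<open>(u, v)\<close> and \<open>(v, w)\<close>.\<close>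

lemma ic_assoc:
  assumes "u \<in> Ar B" "v \<in> Ar B" "w \<in> Ar B" "Dom B u = Dom B w" "Dom B v = Dom B w"
    "Cod B u = iarr C" "Cod B v = iarr C" "Cod B w = iarr C"
    "icod C \<cdot> u = idom C \<cdot> v" "icod C \<cdot> v = idom C \<cdot> w"
  shows "ic B C (ic B C u v) w = ic B C u (ic B C v w)"
proof -
  let ?q = "Pr1 B (cp2 C) (cp1 C)" and ?r = "Pr2 B (cp2 C) (cp1 C)"
  let ?uv = "med B (cp1 C) (cp2 C) u v" and ?vw = "med B (cp1 C) (cp2 C) v w"
  let ?t = "pbmed B (cp2 C) (cp1 C) ?uv ?vw"
  note m = comp_pair_simps[of u v] comp_pair_simps[of v w]
  have t: "?t \<in> Ar B" "Dom B ?t = Dom B w" "Cod B ?t = Dom B ?q" "?q \<cdot> ?t = ?uv" "?r \<cdot> ?t = ?vw"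
    using pbmed_simps[of "cp2 C" "cp1 C" ?uv ?vw] m assms by auto
  have qr: "cp2 C \<cdot> ?q = cp1 C \<cdot> ?r"
    by (rule Pr_commute) auto
  \<comment> \<open>Facts \<open>1\<close> and \<open>2\<close> make both bracketings of the generic
    triple composable, as \<open>ic_Cmp\<close> demands before \<open>?t\<close> can be moved
    inside.\<close>
  have "icod C \<cdot> (icmp C \<cdot> ?q) = icod C \<cdot> (cp2 C \<cdot> ?q)"
    by (rule Cmp_extend[OF cod_cmp]) auto
  also have "\<dots> = icod C \<cdot> (cp1 C \<cdot> ?r)"
    by (simp only: qr)
  also have "\<dots> = idom C \<cdot> (cp2 C \<cdot> ?r)"
    by (rule Cmp_extend) (auto simp: pullbackD(9)[OF comps_pullback])
  finally have 1: "icod C \<cdot> (icmp C \<cdot> ?q) = idom C \<cdot> (cp2 C \<cdot> ?r)" .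
  have "icod C \<cdot> (cp1 C \<cdot> ?q) = idom C \<cdot> (cp2 C \<cdot> ?q)"
    by (rule Cmp_extend) (auto simp: pullbackD(9)[OF comps_pullback])
  also have "\<dots> = idom C \<cdot> (cp1 C \<cdot> ?r)"
    by (simp only: qr)
  also have "\<dots> = idom C \<cdot> (icmp C \<cdot> ?r)"
    by (rule Cmp_extend[OF dom_cmp[symmetric]]) auto
  finally have 2: "icod C \<cdot> (cp1 C \<cdot> ?q) = idom C \<cdot> (icmp C \<cdot> ?r)" .
  have "ic B C (icmp C \<cdot> ?q) (cp2 C \<cdot> ?r) \<cdot> ?t = ic B C (cp1 C \<cdot> ?q) (icmp C \<cdot> ?r) \<cdot> ?t"
    using assoc by (simp add: Let_def)
  then have "ic B C (icmp C \<cdot> ?uv) (cp2 C \<cdot> ?vw) = ic B C (cp1 C \<cdot> ?uv) (icmp C \<cdot> ?vw)"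
    using 1 2 t by (simp add: ic_Cmp)
  then show ?thesis
    using m assms by (simp add: ic_def)
qed

end

locale internal_finlim_cat = finlim_category B + internal_finlim_category B C
  for B :: "('o, 'm, 'x) fcat_scheme" (structure) and C :: "('o, 'm, 'y) ificat_scheme"

sublocale internal_finlim_cat \<subseteq> internal_cat
  by unfold_locales

context internal_finlim_cat
begin

lemma limit_structure_simps [simp]:
  "ione C \<in> Ar B" "Dom B (ione C) = \<one>" "Cod B (ione C) = iobj C"
  "ibang C \<in> Ar B" "Dom B (ibang C) = iobj C" "Cod B (ibang C) = iarr C"
  "ipl C \<in> Ar B" "Dom B (ipl C) = Pb B (icod C) (icod C)" "Cod B (ipl C) = iarr C"
  "ipr C \<in> Ar B" "Dom B (ipr C) = Pb B (icod C) (icod C)" "Cod B (ipr C) = iarr C"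
  "imed C \<in> Ar B" "Dom B (imed C) = Pb B (icmp C) (icmp C)" "Cod B (imed C) = iarr C"
  using ione_in ibang_in ipl_in ipr_in imed_in by (auto simp: in_hom_iff)

lemma stage_simps [simp]:
  "Ob (stage B C T) = hom B T (iobj C)" "Ar (stage B C T) = hom B T (iarr C)"
  "Dom (stage B C T) u = idom C \<cdot> u" "Cod (stage B C T) u = icod C \<cdot> u"
  "Idn (stage B C T) X = iid C \<cdot> X" "v \<cdot>\<^bsub>stage B C T\<^esub> u = ic B C u v"
  "One (stage B C T) = ione C \<cdot> bang B T"
  "Pr1 (stage B C T) u v = ipl C \<cdot> pbmed B (icod C) (icod C) u v"
  "Pr2 (stage B C T) u v = ipr C \<cdot> pbmed B (icod C) (icod C) u v"
  by (simp_all add: stage_def Gam_def)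

lemma stage_One: "stage B C \<one> = Gam B C"
  by (simp add: stage_def Gam_def)

lemma stage_category: "category (stage B C T)"
proof
qed (auto simp: hom_def ic_simps ic_assoc)

text \<open>The axiom \<open>ibang_unique\<close> is the case of the generic arrow into
  \<open>ione C\<close>; \<open>u\<close> factors through it by \<open>?t\<close>.\<close>

lemma stage_to_One:
  assumes "u \<in> Ar B" "Cod B u = iarr C" "icod C \<cdot> u = ione C \<cdot> bang B (Dom B u)"
  shows "u = ibang C \<cdot> (idom C \<cdot> u)"
proof -
  let ?q = "Pr1 B (icod C) (ione C)"
  let ?t = "pbmed B (icod C) (ione C) u (bang B (Dom B u))"
  have t: "?t \<in> Ar B" "Dom B ?t = Dom B u" "Cod B ?t = Dom B ?q" "?q \<cdot> ?t = u"
    using pbmed_simps[of "icod C" "ione C" u "bang B (Dom B u)"] assms by auto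
  have "ibang C \<cdot> (idom C \<cdot> ?q) \<cdot> ?t = ?q \<cdot> ?t"
    using ibang_unique by (simp add: Let_def)
  with t show ?thesis by simp
qed

lemma stage_terminal:
  assumes T: "T \<in> Ob B"
  shows "is_terminal (stage B C T) (One (stage B C T))"
  unfolding is_terminal_def
proof (intro conjI ballI ex1I)
  show "One (stage B C T) \<in> Ob (stage B C T)"
    using T by (simp add: in_hom_iff)
next
  fix X assume X: "X \<in> Ob (stage B C T)"
  then show "ibang C \<cdot> X \<in> hom (stage B C T) X (One (stage B C T))"
    using Cmp_extend1[OF dom_ibang, of X] Cmp_extend1[OF cod_ibang, of X] by (auto simp: hom_def)
  show "t = ibang C \<cdot> X" if "t \<in> hom (stage B C T) X (One (stage B C T))" for t
    using that stage_to_One[of t] by (auto simp: hom_def)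
qed

section \<open>Internal pullbacks of generalised cospans\<close>

context
  fixes T f g
  assumes fg: "f \<in> Ar B" "g \<in> Ar B" "Dom B f = Dom B g" "Cod B f = iarr C" "Cod B g = iarr C"
    "icod C \<cdot> f = icod C \<cdot> g"
begin

text \<open>Classifies the cospan \<open>(f, g)\<close>, so that \<open>ipl C \<cdot> c\<close> and
  \<open>ipr C \<cdot> c\<close> are the projections of its chosen pullback.\<close>

private abbreviation "c \<equiv> pbmed B (icod C) (icod C) f g"

lemma cospan_simps [simp]:
  "c \<in> Ar B" "Dom B c = Dom B g" "Cod B c = Pb B (icod C) (icod C)"
  "Pr1 B (icod C) (icod C) \<cdot> c = f" "Pr2 B (icod C) (icod C) \<cdot> c = g"
  using pbmed_simps[of "icod C" "icod C" f g] fg by auto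

lemma ipb_simps [simp]:
  "idom C \<cdot> (ipr C \<cdot> c) = idom C \<cdot> (ipl C \<cdot> c)"
  "icod C \<cdot> (ipl C \<cdot> c) = idom C \<cdot> f" "icod C \<cdot> (ipr C \<cdot> c) = idom C \<cdot> g"
  using Cmp_extend[OF dom_ipl_ipr, of c] Cmp_extend[OF cod_ipl, of c] Cmp_extend[OF cod_ipr, of c] fg
  by simp_all

lemma ipb_commute: "ic B C (ipl C \<cdot> c) f = ic B C (ipr C \<cdot> c) g"
  using arg_cong[OF ipb_commutes, of "\<lambda>x. x \<cdot> c"] fg by (simp add: ic_Cmp cod_ipl cod_ipr)

lemma cospan_Cmp:
  assumes "t \<in> Ar B" "Cod B t = Dom B g"
  shows "c \<cdot> t = pbmed B (icod C) (icod C) (f \<cdot> t) (g \<cdot> t)"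
  using assms fg by (intro pbmed_Cmp) auto

text \<open>The witness is \<open>imed C \<cdot> ?t\<close>, where \<open>?t\<close> classifies the
  commutative square with sides \<open>(u, f)\<close> and \<open>(v, g)\<close>; the equations are
  those of \<open>imed_mediates\<close> precomposed with \<open>?t\<close>.\<close>

lemma ipb_ex:
  assumes uv: "u \<in> Ar B" "v \<in> Ar B" "Dom B u = Dom B g" "Dom B v = Dom B g"
    "Cod B u = iarr C" "Cod B v = iarr C"
    "icod C \<cdot> u = idom C \<cdot> f" "icod C \<cdot> v = idom C \<cdot> g" "ic B C u f = ic B C v g"
  obtains m where "m \<in> Ar B" "Dom B m = Dom B g" "Cod B m = iarr C" "idom C \<cdot> m = idom C \<cdot> u"
    "icod C \<cdot> m = idom C \<cdot> (ipl C \<cdot> c)" "ic B C m (ipl C \<cdot> c) = u" "ic B C m (ipr C \<cdot> c) = v"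
proof -
  let ?uf = "med B (cp1 C) (cp2 C) u f" and ?vg = "med B (cp1 C) (cp2 C) v g"
  let ?t = "pbmed B (icmp C) (icmp C) ?uf ?vg"
  let ?s1 = "Pr1 B (icmp C) (icmp C)" and ?s2 = "Pr2 B (icmp C) (icmp C)"
  let ?f = "cp2 C \<cdot> ?s1" and ?g = "cp2 C \<cdot> ?s2"
  let ?c = "pbmed B (icod C) (icod C) ?f ?g"
  note m = comp_pair_simps[of u f] comp_pair_simps[of v g]
  have t: "?t \<in> Ar B" "Dom B ?t = Dom B g" "Cod B ?t = Dom B ?s1" "?s1 \<cdot> ?t = ?uf" "?s2 \<cdot> ?t = ?vg"
    using pbmed_simps[of "icmp C" "icmp C" ?uf ?vg] m uv fg by (auto simp: ic_def)
  have s: "icmp C \<cdot> ?s1 = icmp C \<cdot> ?s2"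
    by (rule Pr_commute) auto
  have "icod C \<cdot> ?f = icod C \<cdot> (icmp C \<cdot> ?s1)"
    by (rule Cmp_extend[OF cod_cmp[symmetric]]) auto
  also have "\<dots> = icod C \<cdot> (icmp C \<cdot> ?s2)" by (simp only: s)
  also have "\<dots> = icod C \<cdot> ?g"
    by (rule Cmp_extend[OF cod_cmp]) auto
  finally have fg': "icod C \<cdot> ?f = icod C \<cdot> ?g" .
  have c: "?c \<in> Ar B" "Dom B ?c = Dom B ?s2" "Cod B ?c = Pb B (icod C) (icod C)"
    using pbmed_simps[of "icod C" "icod C" ?f ?g] fg' by auto
  have ct: "?c \<cdot> ?t = c"
    using fg' t m uv fg by (subst pbmed_Cmp) auto
  note im = imed_mediates[unfolded Let_def]
  have "icod C \<cdot> imed C = idom C \<cdot> (ipl C \<cdot> ?c)" "idom C \<cdot> imed C = idom C \<cdot> (cp1 C \<cdot> ?s1)"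
    using im by auto
  then have 1: "icod C \<cdot> (imed C \<cdot> ?t) = idom C \<cdot> (ipl C \<cdot> c)" "idom C \<cdot> (imed C \<cdot> ?t) = idom C \<cdot> u"
    using Cmp_extend[of "icod C" "imed C" "idom C" "ipl C \<cdot> ?c" ?t]
      Cmp_extend[of "idom C" "imed C" "idom C" "cp1 C \<cdot> ?s1" ?t] t c ct m uv fg by simp_all
  have i1: "icod C \<cdot> imed C = idom C \<cdot> (ipl C \<cdot> ?c)"
    and e1: "ic B C (imed C) (ipl C \<cdot> ?c) = cp1 C \<cdot> ?s1"
    and e2: "ic B C (imed C) (ipr C \<cdot> ?c) = cp1 C \<cdot> ?s2"
    using im by auto
  \<comment> \<open>The two projections have the same domain, so the mediating arrow is composable
    with the second one as well.\<close>
  have i2: "icod C \<cdot> imed C = idom C \<cdot> (ipr C \<cdot> ?c)"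
    unfolding i1 using c by (intro Cmp_extend[OF dom_ipl_ipr]) auto
  have "ic B C (imed C \<cdot> ?t) (ipl C \<cdot> c) = u"
    using ic_Cmp[of "imed C" "ipl C \<cdot> ?c" ?t] i1 t c ct m uv fg unfolding e1 by simp
  moreover have "ic B C (imed C \<cdot> ?t) (ipr C \<cdot> c) = v"
    using ic_Cmp[of "imed C" "ipr C \<cdot> ?c" ?t] i2 t c ct m uv fg unfolding e2 by simp
  ultimately show ?thesis
    using 1 that[of "imed C \<cdot> ?t"] t by auto
qed

text \<open>Recovers \<open>m\<close> from its two composites with the projections by an explicit
  formula, which yields uniqueness. It is \<open>imed_unique\<close> precomposed with the arrow
  classifying the pair of \<open>m\<close> and the cospan.\<close>

lemma ipb_unique:
  assumes m: "m \<in> Ar B" "Dom B m = Dom B g" "Cod B m = iarr C" "icod C \<cdot> m = idom C \<cdot> (ipl C \<cdot> c)"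
  shows "imed C \<cdot> pbmed B (icmp C) (icmp C)
    (med B (cp1 C) (cp2 C) (ic B C m (ipl C \<cdot> c)) f)
    (med B (cp1 C) (cp2 C) (ic B C m (ipr C \<cdot> c)) g) = m"
proof -
  let ?e = "idom C \<cdot> ipl C"
  let ?m = "Pr1 B (icod C) ?e" and ?c = "Pr2 B (icod C) ?e"
  let ?f = "Pr1 B (icod C) (icod C) \<cdot> ?c" and ?g = "Pr2 B (icod C) (icod C) \<cdot> ?c"
  let ?h = "ic B C ?m (ipl C \<cdot> ?c)" and ?k = "ic B C ?m (ipr C \<cdot> ?c)"
  let ?t = "pbmed B (icod C) ?e m c"
  have t: "?t \<in> Ar B" "Dom B ?t = Dom B g" "Cod B ?t = Dom B ?m" "?m \<cdot> ?t = m" "?c \<cdot> ?t = c"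
    using pbmed_simps[of "icod C" ?e m c] m fg by auto
  have 1: "icod C \<cdot> ?m = idom C \<cdot> (ipl C \<cdot> ?c)"
    using Pr_commute[of "icod C" ?e] by simp
  have 2: "icod C \<cdot> ?m = idom C \<cdot> (ipr C \<cdot> ?c)"
    unfolding 1 by (intro Cmp_extend[OF dom_ipl_ipr]) auto
  have cl: "icod C \<cdot> (ipl C \<cdot> ?c) = idom C \<cdot> ?f" and cr: "icod C \<cdot> (ipr C \<cdot> ?c) = idom C \<cdot> ?g"
    by (intro Cmp_extend[OF cod_ipl] Cmp_extend[OF cod_ipr]; auto)+
  have h: "?h \<in> Ar B" "Dom B ?h = Dom B ?m" "Cod B ?h = iarr C" "icod C \<cdot> ?h = idom C \<cdot> ?f"
    and k: "?k \<in> Ar B" "Dom B ?k = Dom B ?m" "Cod B ?k = iarr C" "icod C \<cdot> ?k = idom C \<cdot> ?g"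
    using 1 2 cl cr by (simp_all add: ic_simps)
  have ht: "?h \<cdot> ?t = ic B C m (ipl C \<cdot> c)" and kt: "?k \<cdot> ?t = ic B C m (ipr C \<cdot> c)"
    using 1 2 t by (simp_all add: ic_Cmp)
  let ?hf = "med B (cp1 C) (cp2 C) ?h ?f" and ?kg = "med B (cp1 C) (cp2 C) ?k ?g"
  note hf = comp_pair_simps[of ?h ?f] and kg = comp_pair_simps[of ?k ?g]
  have hft: "?hf \<cdot> ?t = med B (cp1 C) (cp2 C) (ic B C m (ipl C \<cdot> c)) f"
    and kgt: "?kg \<cdot> ?t = med B (cp1 C) (cp2 C) (ic B C m (ipr C \<cdot> c)) g"
    using h k t ht kt by (simp_all add: comp_pair_Cmp)
  \<comment> \<open>Commutativity of the generic pullback square makes \<open>?hf\<close> and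
    \<open>?kg\<close> have equal composites, so that they induce an arrow into the object of
    commutative squares.\<close>
  have "ic B C (ipl C) (Pr1 B (icod C) (icod C)) \<cdot> ?c = ic B C (ipr C) (Pr2 B (icod C) (icod C)) \<cdot> ?c"
    by (simp only: ipb_commutes)
  then have "ic B C (ipl C \<cdot> ?c) ?f = ic B C (ipr C \<cdot> ?c) ?g"
    by (simp add: ic_Cmp cod_ipl cod_ipr)
  then have "ic B C ?h ?f = ic B C ?k ?g"
    using 1 2 cl cr by (simp add: ic_assoc)
  then have hk: "icmp C \<cdot> ?hf = icmp C \<cdot> ?kg"
    by (simp only: ic_def)
  have "(imed C \<cdot> pbmed B (icmp C) (icmp C) ?hf ?kg) \<cdot> ?t = ?m \<cdot> ?t"
    using imed_unique by (simp add: Let_def)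
  moreover have "pbmed B (icmp C) (icmp C) ?hf ?kg \<cdot> ?t = pbmed B (icmp C) (icmp C) (?hf \<cdot> ?t) (?kg \<cdot> ?t)"
    using hk hf kg h k t by (intro pbmed_Cmp) auto
  ultimately show ?thesis
    using t hft kgt hk hf kg h k pbmed_simps[of "icmp C" "icmp C" ?hf ?kg] by simp
qed

end

end

context internal_finlim_cat
begin

lemma stage_pullback:
  assumes "is_cospan (stage B C T) f g"
  shows "is_pullback (stage B C T) f g (Pr1 (stage B C T) f g) (Pr2 (stage B C T) f g)"
proof -
  have fg: "f \<in> Ar B" "g \<in> Ar B" "Dom B f = Dom B g" "Dom B g = T" "Cod B f = iarr C"
    "Cod B g = iarr C" "icod C \<cdot> f = icod C \<cdot> g"
    using assms by (auto simp: is_cospan_def hom_def)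
  let ?c = "pbmed B (icod C) (icod C) f g"
  note fg' = fg(1-3,5-7)
  note [simp] = fg cospan_simps[OF fg'] ipb_simps[OF fg']
  show ?thesis
    unfolding is_pullback_def
  proof (intro conjI ballI impI)
    show "is_cospan (stage B C T) f g" by fact
    show "Pr1 (stage B C T) f g \<in> hom (stage B C T) (Dom (stage B C T) (Pr1 (stage B C T) f g)) (Dom (stage B C T) f)"
      "Pr2 (stage B C T) f g \<in> hom (stage B C T) (Dom (stage B C T) (Pr1 (stage B C T) f g)) (Dom (stage B C T) g)"
      by (auto simp: hom_def)
    show "f \<cdot>\<^bsub>stage B C T\<^esub> Pr1 (stage B C T) f g = g \<cdot>\<^bsub>stage B C T\<^esub> Pr2 (stage B C T) f g"
      using ipb_commute[OF fg'] by simp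
    fix X u v
    assume "X \<in> Ob (stage B C T)" "u \<in> hom (stage B C T) X (Dom (stage B C T) f)"
      "v \<in> hom (stage B C T) X (Dom (stage B C T) g)"
      "f \<cdot>\<^bsub>stage B C T\<^esub> u = g \<cdot>\<^bsub>stage B C T\<^esub> v"
    then have uv: "u \<in> Ar B" "v \<in> Ar B" "Dom B u = Dom B g" "Dom B v = Dom B g"
      "Cod B u = iarr C" "Cod B v = iarr C"
      "icod C \<cdot> u = idom C \<cdot> f" "icod C \<cdot> v = idom C \<cdot> g" "ic B C u f = ic B C v g"
      and X: "idom C \<cdot> u = X"
      by (auto simp: hom_def)
    obtain m where m: "m \<in> Ar B" "Dom B m = T" "Cod B m = iarr C" "idom C \<cdot> m = idom C \<cdot> u"
      "icod C \<cdot> m = idom C \<cdot> (ipl C \<cdot> ?c)" "ic B C m (ipl C \<cdot> ?c) = u" "ic B C m (ipr C \<cdot> ?c) = v"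
      using ipb_ex[OF fg' uv] by auto
    show "\<exists>!w. w \<in> hom (stage B C T) X (Dom (stage B C T) (Pr1 (stage B C T) f g)) \<and>
        Pr1 (stage B C T) f g \<cdot>\<^bsub>stage B C T\<^esub> w = u \<and>
        Pr2 (stage B C T) f g \<cdot>\<^bsub>stage B C T\<^esub> w = v"
    proof (rule ex1I)
      show "m \<in> hom (stage B C T) X (Dom (stage B C T) (Pr1 (stage B C T) f g)) \<and>
        Pr1 (stage B C T) f g \<cdot>\<^bsub>stage B C T\<^esub> m = u \<and> Pr2 (stage B C T) f g \<cdot>\<^bsub>stage B C T\<^esub> m = v"
        using m X by (auto simp: hom_def)
      fix w
      assume "w \<in> hom (stage B C T) X (Dom (stage B C T) (Pr1 (stage B C T) f g)) \<and>
        Pr1 (stage B C T) f g \<cdot>\<^bsub>stage B C T\<^esub> w = u \<and> Pr2 (stage B C T) f g \<cdot>\<^bsub>stage B C T\<^esub> w = v"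
      then have w: "w \<in> Ar B" "Dom B w = Dom B g" "Cod B w = iarr C"
        "icod C \<cdot> w = idom C \<cdot> (ipl C \<cdot> ?c)"
        "ic B C w (ipl C \<cdot> ?c) = u" "ic B C w (ipr C \<cdot> ?c) = v"
        by (auto simp: hom_def)
      \<comment> \<open>Both arrows equal the same formula in \<open>u\<close>, \<open>v\<close>,
        \<open>f\<close>, \<open>g\<close>.\<close>
      show "w = m"
        using ipb_unique[OF fg' w(1-4)] ipb_unique[OF fg', of m] m w(5,6) fg(4) by metis
    qed
  qed
qed

lemma stage_finlim:
  assumes "T \<in> Ob B"
  shows "finlim_category (stage B C T)"
proof -
  interpret category "stage B C T" by (rule stage_category)
  show ?thesis
    by unfold_locales (use stage_terminal[OF assms] stage_pullback in blast)+
qed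

end

section \<open>Change of stage\<close>

definition reindex :: "('o, 'm, 'x) cat_scheme \<Rightarrow> 'm \<Rightarrow> ('m, 'm, 'm, 'm) fctr" where
  "reindex B t = \<lparr>omap = \<lambda>X. X \<cdot>\<^bsub>B\<^esub> t, amap = \<lambda>f. f \<cdot>\<^bsub>B\<^esub> t\<rparr>"

context internal_finlim_cat
begin

lemma reindex_functor:
  assumes "t \<in> hom B T S"
  shows "is_functor (stage B C S) (stage B C T) (reindex B t)"
  using assms by (auto simp: is_functor_def reindex_def hom_def ic_Cmp)

text \<open>Chosen limits at a stage arise by composing fixed arrows of \<open>B\<close> after a
  classifying arrow; precomposition with \<open>t\<close> acts on the latter alone, so the limits
  are preserved on the nose.\<close>

lemma reindex_strict:
  assumes "t \<in> hom B T S"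
  shows "strictly_preserves_finlims (stage B C S) (stage B C T) (reindex B t)"
  unfolding strictly_preserves_finlims_def
proof (intro conjI allI impI)
  show "omap (reindex B t) (One (stage B C S)) = One (stage B C T)"
    using assms by (auto simp: reindex_def hom_def)
  fix f g assume "is_cospan (stage B C S) f g"
  then have fg: "f \<in> Ar B" "g \<in> Ar B" "Dom B f = Dom B g" "Cod B f = iarr C" "Cod B g = iarr C"
    "icod C \<cdot> f = icod C \<cdot> g" and S: "Dom B g = S"
    by (auto simp: is_cospan_def hom_def)
  have t: "t \<in> Ar B" "Cod B t = Dom B g"
    using assms S by (auto simp: in_hom_iff)
  show "omap (reindex B t) (Pb (stage B C S) f g) =
      Pb (stage B C T) (amap (reindex B t) f) (amap (reindex B t) g)"
    "amap (reindex B t) (Pr1 (stage B C S) f g) =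
      Pr1 (stage B C T) (amap (reindex B t) f) (amap (reindex B t) g)"
    "amap (reindex B t) (Pr2 (stage B C S) f g) =
      Pr2 (stage B C T) (amap (reindex B t) f) (amap (reindex B t) g)"
    using t cospan_Cmp[OF fg t] cospan_simps[OF fg] by (simp_all add: reindex_def)
qed

end

subsection \<open>Strict functors\<close>

lemma fcomp_functor:
  assumes "is_functor A B F" "is_functor B E G"
  shows "is_functor A E (fcomp G F)"
  using is_functorD[OF assms(1)] is_functorD[OF assms(2)]
  by (simp add: is_functor_def fcomp_def hom_def)

lemma fcomp_strict:
  assumes "strictly_preserves_finlims A B F" "strictly_preserves_finlims B E G" "is_functor A B F"
  shows "strictly_preserves_finlims A E (fcomp G F)"
proof -
  have "is_cospan B (amap F f) (amap F g)" if "is_cospan A f g" for f g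
    using that is_functorD[OF assms(3)] by (simp add: is_cospan_def)
  then show ?thesis
    using assms(1,2) by (simp add: strictly_preserves_finlims_def fcomp_def)
qed

locale strict_functor = A: finlim_category A + B: finlim_category B
  for A :: "('o, 'm, 'x) fcat_scheme" and B :: "('p, 'n, 'y) fcat_scheme" +
  fixes G :: "('o, 'm, 'p, 'n) fctr"
  assumes fctr: "is_functor A B G"
    and strict: "strictly_preserves_finlims A B G"
begin

lemmas fctr_simps [simp] = is_functorD[OF fctr]

lemma fctr_One [simp]: "omap G \<one>\<^bsub>A\<^esub> = \<one>\<^bsub>B\<^esub>"
  using strict by (simp add: strictly_preserves_finlims_def)

lemma fctr_bang [simp]: "X \<in> Ob A \<Longrightarrow> amap G (bang A X) = bang B (omap G X)"
  using B.bang_eqI[of "amap G (bang A X)"] by simp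

lemma fctr_pullback:
  assumes "f \<in> Ar A" "g \<in> Ar A" "Cod A f = Cod A g"
  shows "is_pullback B (amap G f) (amap G g) (amap G (Pr1 A f g)) (amap G (Pr2 A f g))"
  using strict assms B.chosen_pullback[of "amap G f" "amap G g"]
  by (simp add: strictly_preserves_finlims_def is_cospan_def)

end

subsection \<open>Hom-objects\<close>

context internal_cat
begin

context
  fixes X Y
  assumes XY: "X \<in> Ar B" "Dom B X = \<one>" "Cod B X = iobj C"
    "Y \<in> Ar B" "Dom B Y = \<one>" "Cod B Y = iobj C"
begin

lemma hom_incl_simps [simp]:
  "hom_incl B C X Y \<in> Ar B" "Dom B (hom_incl B C X Y) = hom_obj B C X Y"
  "Cod B (hom_incl B C X Y) = iarr C" "hom_obj B C X Y \<in> Ob B"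
  "idom C \<cdot> hom_incl B C X Y = X \<cdot> bang B (hom_obj B C X Y)"
  "icod C \<cdot> hom_incl B C X Y = Y \<cdot> bang B (hom_obj B C X Y)"
proof -
  let ?d = "domcod B C" and ?p = "pairing B (iobj C) (iobj C) X Y"
  let ?i = "Pr1 B ?d ?p" and ?b = "Pr2 B ?d ?p"
  let ?p1 = "Pr1 B (bang B (iobj C)) (bang B (iobj C))"
  let ?p2 = "Pr2 B (bang B (iobj C)) (bang B (iobj C))"
  note d = pairing_simps[of "idom C" "icod C", OF _ _ _ refl refl, simplified, folded domcod_def]
  note p = pairing_simps[of X Y, OF _ _ _ XY(3) XY(6), simplified XY, simplified]
  have i: "?i \<in> Ar B" "?b \<in> Ar B" "Cod B ?i = iarr C" "Cod B ?b = \<one>" "Dom B ?b = Dom B ?i"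
    using d p by auto
  have b: "?b = bang B (Dom B ?i)"
    using bang_eqI[of ?b] i by simp
  have eq: "?d \<cdot> ?i = ?p \<cdot> ?b"
    using d p by (intro Pr_commute) auto
  \<comment> \<open>Projecting the pullback equation onto the two factors separates the domain from
    the codomain.\<close>
  have "?p1 \<cdot> (?d \<cdot> ?i) = ?p1 \<cdot> (?p \<cdot> ?b)" "?p2 \<cdot> (?d \<cdot> ?i) = ?p2 \<cdot> (?p \<cdot> ?b)"
    by (simp_all only: eq)
  then have "idom C \<cdot> ?i = X \<cdot> ?b" "icod C \<cdot> ?i = Y \<cdot> ?b"
    using Cmp_extend1[of ?p1 ?d "idom C" ?i] Cmp_extend1[of ?p2 ?d "icod C" ?i]
      Cmp_extend1[of ?p1 ?p X ?b] Cmp_extend1[of ?p2 ?p Y ?b] d p i by simp_all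
  with i b show "hom_incl B C X Y \<in> Ar B" "Dom B (hom_incl B C X Y) = hom_obj B C X Y"
    "Cod B (hom_incl B C X Y) = iarr C" "hom_obj B C X Y \<in> Ob B"
    "idom C \<cdot> hom_incl B C X Y = X \<cdot> bang B (hom_obj B C X Y)"
    "icod C \<cdot> hom_incl B C X Y = Y \<cdot> bang B (hom_obj B C X Y)"
    by (auto simp: hom_incl_def hom_obj_def)
qed

text \<open>The other leg of the defining pullback ends in the terminal object, so
  \<open>hom_incl\<close> alone determines an arrow into the hom-object.\<close>

lemma hom_incl_mono:
  assumes "w \<in> Ar B" "w' \<in> Ar B" "Dom B w = Dom B w'" "Cod B w = hom_obj B C X Y"
    "Cod B w' = hom_obj B C X Y" "hom_incl B C X Y \<cdot> w = hom_incl B C X Y \<cdot> w'"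
  shows "w = w'"
proof -
  let ?d = "domcod B C" and ?p = "pairing B (iobj C) (iobj C) X Y"
  note d = pairing_simps[of "idom C" "icod C", OF _ _ _ refl refl, simplified, folded domcod_def]
  note p = pairing_simps[of X Y, OF _ _ _ XY(3) XY(6), simplified XY, simplified]
  have "Pr2 B ?d ?p \<cdot> w = Pr2 B ?d ?p \<cdot> w'"
    using bang_eqI[of "Pr2 B ?d ?p \<cdot> w"] bang_eqI[of "Pr2 B ?d ?p \<cdot> w'"] assms d p
    by (simp add: hom_obj_def)
  then show ?thesis
    using assms d p by (intro Pr_eqI[of ?d ?p w w']) (auto simp: hom_obj_def hom_incl_def)
qed

context
  fixes u
  assumes u: "u \<in> Ar B" "Cod B u = iarr C" "idom C \<cdot> u = X \<cdot> bang B (Dom B u)"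
    "icod C \<cdot> u = Y \<cdot> bang B (Dom B u)"
begin

lemma hom_elt_simps:
  "hom_elt B C X Y u \<in> Ar B" "Dom B (hom_elt B C X Y u) = Dom B u"
  "Cod B (hom_elt B C X Y u) = hom_obj B C X Y" "hom_incl B C X Y \<cdot> hom_elt B C X Y u = u"
proof -
  let ?d = "domcod B C" and ?p = "pairing B (iobj C) (iobj C) X Y"
  note d = pairing_simps[of "idom C" "icod C", OF _ _ _ refl refl, simplified, folded domcod_def]
  note p = pairing_simps[of X Y, OF _ _ _ XY(3) XY(6), simplified XY, simplified]
  have "?d \<cdot> u = ?p \<cdot> bang B (Dom B u)"
    unfolding domcod_def using u XY by (simp add: pairing_Cmp)
  then show "hom_elt B C X Y u \<in> Ar B" "Dom B (hom_elt B C X Y u) = Dom B u"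
    "Cod B (hom_elt B C X Y u) = hom_obj B C X Y" "hom_incl B C X Y \<cdot> hom_elt B C X Y u = u"
    using pbmed_simps[of ?d ?p u "bang B (Dom B u)"] d p u
    by (simp_all add: hom_elt_def hom_obj_def hom_incl_def)
qed

lemma hom_elt_unique:
  assumes "w \<in> Ar B" "Cod B w = hom_obj B C X Y" "hom_incl B C X Y \<cdot> w = u"
  shows "w = hom_elt B C X Y u"
  using assms hom_elt_simps hom_incl_mono[of w "hom_elt B C X Y u"] u by auto

end

lemma hom_elt_Cmp:
  assumes "u \<in> Ar B" "Cod B u = iarr C" "idom C \<cdot> u = X \<cdot> bang B (Dom B u)"
    "icod C \<cdot> u = Y \<cdot> bang B (Dom B u)" "t \<in> Ar B" "Cod B t = Dom B u"
  shows "hom_elt B C X Y u \<cdot> t = hom_elt B C X Y (u \<cdot> t)"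
proof (rule hom_elt_unique)
  note h = hom_elt_simps[OF assms(1-4)]
  show "hom_elt B C X Y u \<cdot> t \<in> Ar B" "Cod B (hom_elt B C X Y u \<cdot> t) = hom_obj B C X Y"
    "hom_incl B C X Y \<cdot> (hom_elt B C X Y u \<cdot> t) = u \<cdot> t" "u \<cdot> t \<in> Ar B" "Cod B (u \<cdot> t) = iarr C"
    using h assms Cmp_extend1[OF h(4), of t] by auto
  show "idom C \<cdot> (u \<cdot> t) = X \<cdot> bang B (Dom B (u \<cdot> t))" "icod C \<cdot> (u \<cdot> t) = Y \<cdot> bang B (Dom B (u \<cdot> t))"
    using assms XY Cmp_extend[of "idom C" u X "bang B (Dom B u)" t]
      Cmp_extend[of "icod C" u Y "bang B (Dom B u)" t] by auto
qed

end

end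

subsection \<open>The quotation map\<close>

sublocale pregeminal \<subseteq> internal_finlim_cat B C
  by (intro internal_finlim_cat.intro finlim_B finlim_C)

context pregeminal
begin

lemma strict_functor_stage:
  assumes T: "T \<in> Ob B"
  shows "strict_functor B (stage B C T) (fcomp (reindex B (bang B T)) F)"
proof -
  have b: "bang B T \<in> hom B T \<one>"
    using T by (simp add: in_hom_iff)
  interpret S: finlim_category "stage B C T"
    using T by (rule stage_finlim)
  show ?thesis
    using functor_F strict_F reindex_functor[OF b] reindex_strict[OF b]
    by unfold_locales (auto intro: fcomp_functor fcomp_strict simp: stage_One)
qed

lemma F_simps [simp]:
  "X \<in> Ob B \<Longrightarrow> omap F X \<in> Ar B" "X \<in> Ob B \<Longrightarrow> Dom B (omap F X) = \<one>"
  "X \<in> Ob B \<Longrightarrow> Cod B (omap F X) = iobj C"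
  "g \<in> Ar B \<Longrightarrow> amap F g \<in> Ar B" "g \<in> Ar B \<Longrightarrow> Dom B (amap F g) = \<one>"
  "g \<in> Ar B \<Longrightarrow> Cod B (amap F g) = iarr C"
  "g \<in> Ar B \<Longrightarrow> idom C \<cdot> amap F g = omap F (Dom B g)"
  "g \<in> Ar B \<Longrightarrow> icod C \<cdot> amap F g = omap F (Cod B g)"
  using is_functorD[OF functor_F, folded stage_One] by (auto simp: in_hom_iff)

lemma F_One [simp]: "omap F \<one> = ione C"
  using strict_F by (simp add: strictly_preserves_finlims_def Gam_def)

lemma F_Cmp:
  "g \<in> Ar B \<Longrightarrow> h \<in> Ar B \<Longrightarrow> Cod B g = Dom B h \<Longrightarrow> amap F (h \<cdot> g) = ic B C (amap F g) (amap F h)"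
  using is_functorD(6)[OF functor_F, folded stage_One] by simp

section \<open>Elements of \<open>\<box> X\<close> read as arrows of \<open>C\<close>\<close>

abbreviation BoxF ("\<box>") where "BoxF \<equiv> Box B C F"

text \<open>A monic through which an element of \<open>\<box> X\<close>, at any stage, is treated as
  an arrow of \<open>C\<close> from \<open>ione C\<close> to \<open>omap F X\<close>; equations
  about \<open>\<box>\<close> are checked after composing with it.\<close>

definition box_incl :: "'o \<Rightarrow> 'm" where
  "box_incl X = hom_incl B C (ione C) (omap F X)"

lemma box_incl_simps [simp]:
  assumes "X \<in> Ob B"
  shows "omap \<box> X \<in> Ob B" "box_incl X \<in> Ar B" "Dom B (box_incl X) = omap \<box> X"
    "Cod B (box_incl X) = iarr C" "idom C \<cdot> box_incl X = ione C \<cdot> bang B (omap \<box> X)"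
    "icod C \<cdot> box_incl X = omap F X \<cdot> bang B (omap \<box> X)"
  using assms hom_incl_simps[of "ione C" "omap F X"]
  by (simp_all add: box_incl_def Box_def fcomp_def gsec_def)

lemma box_incl_mono:
  assumes "X \<in> Ob B" "w \<in> Ar B" "w' \<in> Ar B" "Dom B w = Dom B w'" "Cod B w = omap \<box> X"
    "Cod B w' = omap \<box> X" "box_incl X \<cdot> w = box_incl X \<cdot> w'"
  shows "w = w'"
  using assms hom_incl_mono[of "ione C" "omap F X" w w']
  by (simp add: box_incl_def Box_def fcomp_def gsec_def)

lemma box_incl_dom_cod [simp]:
  assumes "X \<in> Ob B" "z \<in> Ar B" "Cod B z = omap \<box> X"
  shows "idom C \<cdot> (box_incl X \<cdot> z) = ione C \<cdot> bang B (Dom B z)"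
    "icod C \<cdot> (box_incl X \<cdot> z) = omap F X \<cdot> bang B (Dom B z)"
  using assms Cmp_extend[of "idom C" "box_incl X" "ione C" "bang B (omap \<box> X)" z]
    Cmp_extend[of "icod C" "box_incl X" "omap F X" "bang B (omap \<box> X)" z] by auto

text \<open>Read through \<open>box_incl\<close>, the arrow \<open>amap \<box> g\<close> is internal
  composition with \<open>amap F g\<close>, which \<open>bang\<close> turns into a constant
  family.\<close>

lemma Box_simps [simp]:
  assumes "g \<in> Ar B"
  shows "amap \<box> g \<in> Ar B" "Dom B (amap \<box> g) = omap \<box> (Dom B g)"
    "Cod B (amap \<box> g) = omap \<box> (Cod B g)"
    "box_incl (Cod B g) \<cdot> amap \<box> g =
       ic B C (box_incl (Dom B g)) (amap F g \<cdot> bang B (omap \<box> (Dom B g)))"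
proof -
  let ?X = "omap \<box> (Dom B g)"
  let ?v = "amap F g \<cdot> bang B ?X"
  have v: "?v \<in> Ar B" "Dom B ?v = ?X" "Cod B ?v = iarr C" "idom C \<cdot> ?v = omap F (Dom B g) \<cdot> bang B ?X"
    "icod C \<cdot> ?v = omap F (Cod B g) \<cdot> bang B ?X"
    using assms Cmp_extend1[of "idom C" "amap F g" _ "bang B ?X"]
      Cmp_extend1[of "icod C" "amap F g" _ "bang B ?X"] by auto
  have eq: "amap \<box> g = hom_elt B C (ione C) (omap F (Cod B g)) (ic B C (box_incl (Dom B g)) ?v)"
    using assms by (simp add: Box_def fcomp_def gsec_def box_incl_def Let_def)
  note i = ic_simps[of "box_incl (Dom B g)" ?v]
  show "amap \<box> g \<in> Ar B" "Dom B (amap \<box> g) = ?X" "Cod B (amap \<box> g) = omap \<box> (Cod B g)"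
    "box_incl (Cod B g) \<cdot> amap \<box> g = ic B C (box_incl (Dom B g)) ?v"
    using v i assms
      hom_elt_simps[of "ione C" "omap F (Cod B g)" "ic B C (box_incl (Dom B g)) ?v"]
    unfolding eq by (simp_all add: box_incl_def Box_def fcomp_def gsec_def)
qed

lemma F_bang_dom_cod [simp]:
  assumes "g \<in> Ar B" "T \<in> Ob B"
  shows "idom C \<cdot> (amap F g \<cdot> bang B T) = omap F (Dom B g) \<cdot> bang B T"
    "icod C \<cdot> (amap F g \<cdot> bang B T) = omap F (Cod B g) \<cdot> bang B T"
  using assms by (auto intro!: Cmp_extend1)

lemma box_incl_Box:
  assumes "g \<in> Ar B" "z \<in> Ar B" "Cod B z = omap \<box> (Dom B g)"
  shows "box_incl (Cod B g) \<cdot> (amap \<box> g \<cdot> z) =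
    ic B C (box_incl (Dom B g) \<cdot> z) (amap F g \<cdot> bang B (Dom B z))"
  using assms Cmp_extend1[OF Box_simps(4), of g z] by (simp add: ic_Cmp)

text \<open>The isomorphism from \<open>\<one>\<close> to \<open>\<box> \<one>\<close> names the
  identity of \<open>ione C\<close>; composing that identity with \<open>amap F x\<close> returns
  \<open>amap F x\<close>.\<close>

lemma sharp_simps:
  assumes x: "x \<in> Ar B" "Dom B x = \<one>"
  shows "box_incl (Cod B x) \<cdot> sharp B \<box> x = amap F x"
proof -
  let ?u = "hom_elt B C (ione C) (ione C) (iid C \<cdot> ione C)"
  have u: "?u \<in> Ar B" "Dom B ?u = \<one>" "Cod B ?u = omap \<box> \<one>" "box_incl \<one> \<cdot> ?u = iid C \<cdot> ione C"
    using hom_elt_simps[of "ione C" "ione C" "iid C \<cdot> ione C"]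
    by (simp_all add: box_incl_def Box_def fcomp_def gsec_def)
  \<comment> \<open>An element of \<open>\<box> \<one>\<close> is an arrow of \<open>C\<close> into
    the internal terminal object, so any two at the same stage coincide. This makes
    \<open>?u\<close> the unique isomorphism.\<close>
  have bang: "box_incl \<one> \<cdot> w = ibang C \<cdot> (ione C \<cdot> bang B (Dom B w))"
    if "w \<in> Ar B" "Cod B w = omap \<box> \<one>" for w
  proof -
    have "box_incl \<one> \<cdot> w = ibang C \<cdot> (idom C \<cdot> (box_incl \<one> \<cdot> w))"
      by (rule stage_to_One) (use that in simp_all)
    also have "idom C \<cdot> (box_incl \<one> \<cdot> w) = ione C \<cdot> bang B (Dom B w)"
      using that by simp
    finally show ?thesis .
  qed
  have eqI: "w = w'" if "w \<in> Ar B" "w' \<in> Ar B" "Dom B w = Dom B w'" "Cod B w = omap \<box> \<one>"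
    "Cod B w' = omap \<box> \<one>" for w w'
    by (rule box_incl_mono[of \<one>]) (use that in \<open>simp_all add: bang\<close>)
  have "bang B (omap \<box> \<one>) \<cdot> ?u = Idn B \<one>"
    using u by simp
  moreover have "?u \<cdot> bang B (omap \<box> \<one>) = Idn B (omap \<box> \<one>)"
    by (rule eqI) (use u in simp_all)
  moreover have "bang B (omap \<box> \<one>) \<in> hom B (omap \<box> \<one>) \<one>"
    by (simp add: in_hom_iff)
  ultimately have "iso_in B ?u \<one> (omap \<box> \<one>)"
    using u unfolding iso_in_def in_hom_iff[of ?u] by blast
  moreover have "w = ?u" if "iso_in B w \<one> (omap \<box> \<one>)" for w
    by (rule eqI) (use that u in \<open>simp_all add: iso_in_def in_hom_iff\<close>)
  ultimately have "(THE u. iso_in B u \<one> (omap \<box> \<one>)) = ?u"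
    by (rule the_equality)
  then have "box_incl (Cod B x) \<cdot> sharp B \<box> x = box_incl (Cod B x) \<cdot> (amap \<box> x \<cdot> ?u)"
    by (simp add: sharp_def)
  also have "\<dots> = ic B C (iid C \<cdot> ione C) (amap F x)"
    using box_incl_Box[of x ?u] u x by simp
  also have "\<dots> = amap F x"
    using x by simp
  finally show ?thesis .
qed

definition quote :: "'m \<Rightarrow> 'm" where
  "quote x = box_incl (iarr C) \<cdot> (iamap H \<cdot> x)"

lemma H_simps:
  "iomap H \<in> Ar B" "Dom B (iomap H) = iobj C" "Cod B (iomap H) = omap \<box> (iobj C)"
  "iamap H \<in> Ar B" "Dom B (iamap H) = iarr C" "Cod B (iamap H) = omap \<box> (iarr C)"
  "amap \<box> (idom C) \<cdot> iamap H = iomap H \<cdot> idom C"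
  "amap \<box> (icod C) \<cdot> iamap H = iomap H \<cdot> icod C"
  using functor_H by (auto simp: is_internal_functor_def apply_icat_def in_hom_iff)

context
  fixes x
  assumes x: "x \<in> Ar B" "Cod B x = iarr C"
begin

lemma quote_simps [simp]:
  "quote x \<in> Ar B" "Dom B (quote x) = Dom B x" "Cod B (quote x) = iarr C"
  "idom C \<cdot> quote x = ione C \<cdot> bang B (Dom B x)"
  "icod C \<cdot> quote x = omap F (iarr C) \<cdot> bang B (Dom B x)"
  using x H_simps by (simp_all add: quote_def)

lemma quote_Cmp: "t \<in> Ar B \<Longrightarrow> Cod B t = Dom B x \<Longrightarrow> quote x \<cdot> t = quote (x \<cdot> t)"
  using x H_simps by (simp add: quote_def)

text \<open>Since \<open>H\<close> commutes with domain and codomain, applying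
  \<open>amap F (idom C)\<close> to the code of \<open>x\<close> gives the code of its domain; for a
  constant domain \<open>omap F X\<close>, \<open>H_obj\<close> identifies that code.\<close>

lemma quote_dom_cod:
  assumes "X \<in> Ob B"
  shows "idom C \<cdot> x = omap F X \<cdot> bang B (Dom B x) \<Longrightarrow>
      ic B C (quote x) (amap F (idom C) \<cdot> bang B (Dom B x)) = amap F (omap F X) \<cdot> bang B (Dom B x)"
    "icod C \<cdot> x = omap F X \<cdot> bang B (Dom B x) \<Longrightarrow>
      ic B C (quote x) (amap F (icod C) \<cdot> bang B (Dom B x)) = amap F (omap F X) \<cdot> bang B (Dom B x)"
proof -
  \<comment> \<open>As \<open>omap F X\<close> is itself an arrow of \<open>B\<close>,
    \<open>F\<close> applies to it once more, and \<open>H_obj\<close> says that \<open>H\<close>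
    does the same.\<close>
  have FX: "box_incl (iobj C) \<cdot> (iomap H \<cdot> (omap F X \<cdot> bang B (Dom B x))) =
      amap F (omap F X) \<cdot> bang B (Dom B x)"
  proof -
    have "box_incl (iobj C) \<cdot> (iomap H \<cdot> omap F X) = amap F (omap F X)"
      using H_obj[OF assms] sharp_simps[of "omap F X"] assms by simp
    from Cmp_extend1[OF this, of "bang B (Dom B x)"] show ?thesis
      using assms x H_simps by simp
  qed
  show "ic B C (quote x) (amap F (idom C) \<cdot> bang B (Dom B x)) = amap F (omap F X) \<cdot> bang B (Dom B x)"
    if "idom C \<cdot> x = omap F X \<cdot> bang B (Dom B x)"
  proof -
    have "ic B C (quote x) (amap F (idom C) \<cdot> bang B (Dom B x)) =
        box_incl (iobj C) \<cdot> (amap \<box> (idom C) \<cdot> (iamap H \<cdot> x))"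
      using box_incl_Box[of "idom C" "iamap H \<cdot> x"] x H_simps by (simp add: quote_def)
    also have "amap \<box> (idom C) \<cdot> (iamap H \<cdot> x) = iomap H \<cdot> (idom C \<cdot> x)"
      by (rule Cmp_extend) (use x H_simps in auto)
    finally show ?thesis using that FX by simp
  qed
  show "ic B C (quote x) (amap F (icod C) \<cdot> bang B (Dom B x)) = amap F (omap F X) \<cdot> bang B (Dom B x)"
    if "icod C \<cdot> x = omap F X \<cdot> bang B (Dom B x)"
  proof -
    have "ic B C (quote x) (amap F (icod C) \<cdot> bang B (Dom B x)) =
        box_incl (iobj C) \<cdot> (amap \<box> (icod C) \<cdot> (iamap H \<cdot> x))"
      using box_incl_Box[of "icod C" "iamap H \<cdot> x"] x H_simps by (simp add: quote_def)
    also have "amap \<box> (icod C) \<cdot> (iamap H \<cdot> x) = iomap H \<cdot> (icod C \<cdot> x)"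
      by (rule Cmp_extend) (use x H_simps in auto)
    finally show ?thesis using that FX by simp
  qed
qed

end

text \<open>This is \<open>H_arr\<close> read through \<open>box_incl\<close>: on the image of
  \<open>F\<close>, quotation is a second application of \<open>F\<close>.\<close>

lemma quote_F: "g \<in> Ar B \<Longrightarrow> quote (amap F g) = amap F (amap F g)"
  using H_arr[of g] sharp_simps[of "amap F g"] by (simp add: quote_def)

end

subsection \<open>The self-referential object\<close>

context internal_cat
begin

text \<open>For a global object \<open>Z\<close>, its domain is the object of objects of the
  internal slice over \<open>Z\<close>.\<close>

definition into :: "'m \<Rightarrow> 'm" where
  "into Z = Pr1 B (icod C) Z"

context
  fixes Z
  assumes Z: "Z \<in> Ar B" "Dom B Z = \<one>" "Cod B Z = iobj C"
begin

lemma into_pullback: "is_pullback B (icod C) Z (into Z) (bang B (Dom B (into Z)))"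
  using chosen_pullback[of "icod C" Z] bang_eqI[of "Pr2 B (icod C) Z"] Z by (simp add: into_def)

lemma into_simps [simp]:
  "into Z \<in> Ar B" "Cod B (into Z) = iarr C" "icod C \<cdot> into Z = Z \<cdot> bang B (Dom B (into Z))"
  using pullbackD[OF into_pullback] by auto

lemma into_lift:
  assumes "x \<in> Ar B" "Cod B x = iarr C" "icod C \<cdot> x = Z \<cdot> bang B (Dom B x)"
  obtains w where "w \<in> Ar B" "Dom B w = Dom B x" "Cod B w = Dom B (into Z)" "into Z \<cdot> w = x"
  using med_simps[OF into_pullback, of x "bang B (Dom B x)"] assms Z by auto

end

end

section \<open>The diagonal and the object built from it\<close>

context pregeminal
begin

text \<open>The generic family of objects of \<open>C\<close> indexed by codes of arrows.\<close>

abbreviation (input) fam :: 'm where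
  "fam \<equiv> into (omap F (iarr C))"

text \<open>The fibre is the vertex of an internal pullback, formed once for the generic family; a
  particular family is treated by composing with the arrow that classifies it.\<close>

definition diag :: 'm where
  "diag = idom C \<cdot> (ipl C \<cdot> pbmed B (icod C) (icod C) fam (quote fam))"

lemma diag_simps [simp]: "diag \<in> Ar B" "Dom B diag = Dom B fam" "Cod B diag = iobj C"
  using cospan_simps[of fam "quote fam"] by (simp_all add: diag_def)

text \<open>With \<open>rel2\<close>, the projections of the object of pairs of a family
  \<open>x\<close> and an arrow \<open>y\<close> from its diagonal fibre to
  \<open>omap F A\<close>.\<close>

definition rel1 :: "'o \<Rightarrow> 'm" where
  "rel1 A = Pr1 B diag (idom C \<cdot> into (omap F A))"

definition rel2 :: "'o \<Rightarrow> 'm" where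
  "rel2 A = Pr2 B diag (idom C \<cdot> into (omap F A))"

text \<open>The arrow of \<open>B\<close> sending a pair \<open>(x, y)\<close> to \<open>x\<close>,
  transported by \<open>F\<close>, is again a family indexed by codes: the one to which the diagonal
  is applied.\<close>

definition code :: "'o \<Rightarrow> 'm" where
  "code A = amap F (fam \<cdot> rel1 A)"

text \<open>Selects the pairs \<open>(x, y)\<close> whose family \<open>x\<close> is
  \<open>code A\<close> itself.\<close>

definition fibre :: "'o \<Rightarrow> 'm" where
  "fibre A = Pr1 B (fam \<cdot> rel1 A) (code A)"

definition fix_incl :: "'o \<Rightarrow> 'm" where
  "fix_incl A = into (omap F A) \<cdot> (rel2 A \<cdot> fibre A)"

abbreviation fix_obj :: "'o \<Rightarrow> 'o" where
  "fix_obj A \<equiv> Dom B (fibre A)"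

context
  fixes A
  assumes A: "A \<in> Ob B"
begin

lemma rel_simps [simp]:
  "rel1 A \<in> Ar B" "Cod B (rel1 A) = Dom B fam"
  "rel2 A \<in> Ar B" "Dom B (rel2 A) = Dom B (rel1 A)" "Cod B (rel2 A) = Dom B (into (omap F A))"
  "diag \<cdot> rel1 A = idom C \<cdot> (into (omap F A) \<cdot> rel2 A)"
  using A Pr_commute[of diag "idom C \<cdot> into (omap F A)"] by (simp_all add: rel1_def rel2_def)

lemma code_simps [simp]:
  "code A \<in> Ar B" "Dom B (code A) = \<one>" "Cod B (code A) = iarr C"
  "icod C \<cdot> code A = omap F (iarr C)"
  by (simp_all add: code_def)

lemma fibre_pullback:
  "is_pullback B (fam \<cdot> rel1 A) (code A) (fibre A) (bang B (fix_obj A))"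
  using chosen_pullback[of "fam \<cdot> rel1 A" "code A"] bang_eqI[of "Pr2 B (fam \<cdot> rel1 A) (code A)"]
  by (simp add: fibre_def)

lemma fibre_simps [simp]:
  "fibre A \<in> Ar B" "Cod B (fibre A) = Dom B (rel1 A)"
  "fam \<cdot> (rel1 A \<cdot> fibre A) = code A \<cdot> bang B (fix_obj A)"
  using pullbackD[OF fibre_pullback] by auto

text \<open>The self-reference: \<open>c\<close> is the family \<open>code A\<close> as a global
  element of the object of families, and its diagonal fibre is the \<open>F\<close>-image of the
  very object of pairs lying over it.\<close>

lemma code_lift:
  obtains c where "c \<in> Ar B" "Dom B c = \<one>" "Cod B c = Dom B fam" "fam \<cdot> c = code A"
    "diag \<cdot> c = omap F (fix_obj A)" "rel1 A \<cdot> fibre A = c \<cdot> bang B (fix_obj A)"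
proof -
  obtain c where c: "c \<in> Ar B" "Dom B c = \<one>" "Cod B c = Dom B fam" "fam \<cdot> c = code A"
    using into_lift[of "omap F (iarr C)" "code A"] by auto
  have "diag \<cdot> c = idom C \<cdot> (ipl C \<cdot> pbmed B (icod C) (icod C) (code A) (quote (code A)))"
    using c cospan_simps[of fam "quote fam"] by (simp add: diag_def cospan_Cmp quote_Cmp)
  \<comment> \<open>The family is in the image of \<open>F\<close>, so its quotation is
    \<open>amap F (code A)\<close> and both legs of the internal cospan are
    \<open>F\<close>-images.\<close>
  also have "\<dots> = Pb (Gam B C) (amap F (fam \<cdot> rel1 A)) (amap F (code A))"
    using quote_F[of "fam \<cdot> rel1 A"] by (simp add: stage_One[symmetric] code_def)
  \<comment> \<open>Strictness gives an equality of objects; the cospan under \<open>F\<close> is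
    the one that defines \<open>fibre A\<close>.\<close>
  also have "\<dots> = omap F (fix_obj A)"
    using strict_F by (simp add: strictly_preserves_finlims_def is_cospan_def fibre_def)
  finally have d: "diag \<cdot> c = omap F (fix_obj A)" .
  \<comment> \<open>Both sides have the constant family \<open>code A\<close> as image under the
    monic \<open>fam\<close>.\<close>
  have "rel1 A \<cdot> fibre A = c \<cdot> bang B (fix_obj A)"
    by (rule pullback_eqI[OF into_pullback[of "omap F (iarr C)"]])
      (use c Cmp_extend1[OF c(4), of "bang B (fix_obj A)"] in auto)
  with c d that show ?thesis by blast
qed

lemma fix_incl_simps [simp]:
  "fix_incl A \<in> Ar B" "Dom B (fix_incl A) = fix_obj A" "Cod B (fix_incl A) = iarr C"
  "idom C \<cdot> fix_incl A = omap F (fix_obj A) \<cdot> bang B (fix_obj A)"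
  "icod C \<cdot> fix_incl A = omap F A \<cdot> bang B (fix_obj A)"
proof -
  show "fix_incl A \<in> Ar B" "Dom B (fix_incl A) = fix_obj A" "Cod B (fix_incl A) = iarr C"
    using A by (simp_all add: fix_incl_def)
  show "icod C \<cdot> fix_incl A = omap F A \<cdot> bang B (fix_obj A)"
    unfolding fix_incl_def
    using A Cmp_extend[OF into_simps(3)[of "omap F A"], of "rel2 A \<cdot> fibre A"] by simp
  obtain c where c: "c \<in> Ar B" "Dom B c = \<one>" "Cod B c = Dom B fam"
    "diag \<cdot> c = omap F (fix_obj A)" "rel1 A \<cdot> fibre A = c \<cdot> bang B (fix_obj A)"
    using code_lift by metis
  \<comment> \<open>By the defining square of \<open>rel1\<close> and \<open>rel2\<close>, the
    domain of \<open>y\<close> is the diagonal fibre of \<open>x\<close>, here with \<open>x\<close>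
    constant at \<open>c\<close>.\<close>
  have "idom C \<cdot> fix_incl A = diag \<cdot> (rel1 A \<cdot> fibre A)"
    using Cmp_extend[OF rel_simps(6), of "fibre A"] A by (simp add: fix_incl_def)
  also have "\<dots> = omap F (fix_obj A) \<cdot> bang B (fix_obj A)"
    unfolding c(5) using c(1-3) by (intro Cmp_extend1[OF c(4)]) auto
  finally show "idom C \<cdot> fix_incl A = omap F (fix_obj A) \<cdot> bang B (fix_obj A)" .
qed

text \<open>
  The universal property of \<open>fix_obj A\<close>, in the form in which a functor preserving finite limits
  inherits it. It is needed in \<open>B\<close> itself and inside \<open>C\<close>.
\<close>

context
  fixes E :: "('p, 'n, 'z) fcat_scheme" and G :: "('o, 'm, 'p, 'n) fctr"
  assumes strict_G: "strict_functor B E G"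
begin

interpretation G: strict_functor B E G
  by (rule strict_G)

lemma fix_incl_lift:
  assumes z: "z \<in> Ar E" "Cod E z = omap G (iarr C)"
    and dom: "amap G (idom C) \<cdot>\<^bsub>E\<^esub> z = amap G (omap F (fix_obj A)) \<cdot>\<^bsub>E\<^esub> bang E (Dom E z)"
    and cod: "amap G (icod C) \<cdot>\<^bsub>E\<^esub> z = amap G (omap F A) \<cdot>\<^bsub>E\<^esub> bang E (Dom E z)"
  obtains w where "w \<in> Ar E" "Dom E w = Dom E z" "Cod E w = omap G (fix_obj A)"
    "amap G (fix_incl A) \<cdot>\<^bsub>E\<^esub> w = z"
proof -
  let ?Y = "into (omap F A)" and ?b = "bang E (Dom E z)"
  obtain c where c: "c \<in> Ar B" "Dom B c = \<one>" "Cod B c = Dom B fam" "fam \<cdot> c = code A"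
    "diag \<cdot> c = omap F (fix_obj A)" "rel1 A \<cdot> fibre A = c \<cdot> bang B (fix_obj A)"
    using code_lift by metis
  \<comment> \<open>The element \<open>z\<close> is factored through the three defining pullbacks in
    turn; its codomain gives the first factor \<open>zY\<close>.\<close>
  have "is_pullback E (amap G (icod C)) (amap G (omap F A)) (amap G ?Y) (amap G (Pr2 B (icod C) (omap F A)))"
    using G.fctr_pullback[of "icod C" "omap F A"] A by (simp add: into_def)
  from G.B.med_simps[OF this, of z ?b] A z cod
  obtain zY where zY: "zY \<in> Ar E" "Dom E zY = Dom E z" "Cod E zY = omap G (Dom B ?Y)"
    "amap G ?Y \<cdot>\<^bsub>E\<^esub> zY = z" by auto
  have eq: "amap G diag \<cdot>\<^bsub>E\<^esub> amap G c = amap G (omap F (fix_obj A))"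
    using c(1-3) by (simp add: c(5)[symmetric])
  \<comment> \<open>The family paired with \<open>zY\<close> is the constant \<open>c\<close>: the
    hypothesis on the domain of \<open>z\<close> says that it is the diagonal fibre of
    \<open>c\<close>.\<close>
  have "amap G diag \<cdot>\<^bsub>E\<^esub> (amap G c \<cdot>\<^bsub>E\<^esub> ?b) = amap G (idom C \<cdot> ?Y) \<cdot>\<^bsub>E\<^esub> zY"
    using G.B.Cmp_extend1[OF eq, of ?b] c(1-3) z zY A dom by simp
  moreover have "is_pullback E (amap G diag) (amap G (idom C \<cdot> ?Y)) (amap G (rel1 A)) (amap G (rel2 A))"
    using G.fctr_pullback[of diag "idom C \<cdot> ?Y"] A by (simp add: rel1_def rel2_def)
  ultimately obtain zR where zR: "zR \<in> Ar E" "Dom E zR = Dom E z" "Cod E zR = omap G (Dom B (rel1 A))"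
    "amap G (rel1 A) \<cdot>\<^bsub>E\<^esub> zR = amap G c \<cdot>\<^bsub>E\<^esub> ?b" "amap G (rel2 A) \<cdot>\<^bsub>E\<^esub> zR = zY"
    using G.B.med_simps[of "amap G diag" "amap G (idom C \<cdot> ?Y)" "amap G (rel1 A)" "amap G (rel2 A)"
        "amap G c \<cdot>\<^bsub>E\<^esub> ?b" zY] c(1-3) zY z A by auto
  have eq: "amap G fam \<cdot>\<^bsub>E\<^esub> amap G c = amap G (code A)"
    using c(1-3) by (simp add: c(4)[symmetric])
  have "amap G (fam \<cdot> rel1 A) \<cdot>\<^bsub>E\<^esub> zR = amap G (code A) \<cdot>\<^bsub>E\<^esub> ?b"
    using G.B.Cmp_extend1[OF eq, of ?b] c(1-3) z zR by simp
  moreover have "is_pullback E (amap G (fam \<cdot> rel1 A)) (amap G (code A)) (amap G (fibre A))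
      (amap G (Pr2 B (fam \<cdot> rel1 A) (code A)))"
    using G.fctr_pullback[of "fam \<cdot> rel1 A" "code A"] by (simp add: fibre_def)
  ultimately obtain w where w: "w \<in> Ar E" "Dom E w = Dom E z" "Cod E w = omap G (fix_obj A)"
    "amap G (fibre A) \<cdot>\<^bsub>E\<^esub> w = zR"
    using G.B.med_simps[of "amap G (fam \<cdot> rel1 A)" "amap G (code A)" "amap G (fibre A)"
        "amap G (Pr2 B (fam \<cdot> rel1 A) (code A))" zR ?b] zR z by auto
  have "amap G (fix_incl A) \<cdot>\<^bsub>E\<^esub> w = z"
    using w zR zY A by (simp add: fix_incl_def)
  with w that show ?thesis by blast
qed

lemma fix_incl_mono:
  assumes w: "w \<in> Ar E" "w' \<in> Ar E" "Dom E w = Dom E w'" "Cod E w = omap G (fix_obj A)"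
    "Cod E w' = omap G (fix_obj A)"
    and eq: "amap G (fix_incl A) \<cdot>\<^bsub>E\<^esub> w = amap G (fix_incl A) \<cdot>\<^bsub>E\<^esub> w'"
  shows "w = w'"
proof -
  let ?Y = "into (omap F A)"
  obtain c where c: "c \<in> Ar B" "Dom B c = \<one>" "Cod B c = Dom B fam"
    "rel1 A \<cdot> fibre A = c \<cdot> bang B (fix_obj A)"
    using code_lift by metis
  have "is_pullback E (amap G (icod C)) (amap G (omap F A)) (amap G ?Y) (amap G (bang B (Dom B ?Y)))"
    using G.fctr_pullback[of "icod C" "omap F A"] A bang_eqI[of "Pr2 B (icod C) (omap F A)"]
    by (simp add: into_def)
  then have 2: "amap G (rel2 A \<cdot> fibre A) \<cdot>\<^bsub>E\<^esub> w = amap G (rel2 A \<cdot> fibre A) \<cdot>\<^bsub>E\<^esub> w'"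
    by (rule G.B.pullback_eqI) (use w A eq in \<open>simp_all add: fix_incl_def\<close>)
  \<comment> \<open>The family components agree because both are constant at \<open>c\<close> and
    have the same domain.\<close>
  have 1: "amap G (rel1 A \<cdot> fibre A) \<cdot>\<^bsub>E\<^esub> w = amap G (rel1 A \<cdot> fibre A) \<cdot>\<^bsub>E\<^esub> w'"
    unfolding c(4) using w c(1-3) by simp
  have "is_pullback E (amap G diag) (amap G (idom C \<cdot> ?Y)) (amap G (rel1 A)) (amap G (rel2 A))"
    using G.fctr_pullback[of diag "idom C \<cdot> ?Y"] A by (simp add: rel1_def rel2_def)
  then have 3: "amap G (fibre A) \<cdot>\<^bsub>E\<^esub> w = amap G (fibre A) \<cdot>\<^bsub>E\<^esub> w'"
    by (rule G.B.pullback_eqI) (use w A 1 2 in simp_all)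
  have "is_pullback E (amap G (fam \<cdot> rel1 A)) (amap G (code A)) (amap G (fibre A))
      (amap G (bang B (fix_obj A)))"
    using G.fctr_pullback[of "fam \<cdot> rel1 A" "code A"] bang_eqI[of "Pr2 B (fam \<cdot> rel1 A) (code A)"]
    by (simp add: fibre_def)
  then show ?thesis
    by (rule G.B.pullback_eqI) (use w 3 in simp_all)
qed

end

section \<open>Self-application and the fixed point\<close>

lemma fixed_point:
  assumes f: "f \<in> hom B (omap \<box> A) A"
  shows "\<exists>a \<in> hom B \<one> A. f \<cdot> hom_elt B C (ione C) (omap F A) (amap F a) = a"
proof -
  let ?D = "fix_obj A" and ?y = "fix_incl A"
  have f': "f \<in> Ar B" "Dom B f = omap \<box> A" "Cod B f = A"
    using f by (auto simp: in_hom_iff)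
  \<comment> \<open>The code of \<open>?y\<close> has the codes of \<open>omap F ?D\<close> and
    \<open>omap F A\<close> as domain and codomain, so the universal property of \<open>?D\<close>,
    transported by \<open>F\<close> into stage \<open>?D\<close>, factors it through
    \<open>amap F ?y\<close>.\<close>
  obtain \<delta> where \<delta>: "\<delta> \<in> Ar B" "Dom B \<delta> = ?D" "Cod B \<delta> = iarr C" "idom C \<cdot> \<delta> = ione C \<cdot> bang B ?D"
    "icod C \<cdot> \<delta> = omap F ?D \<cdot> bang B ?D" "ic B C \<delta> (amap F ?y \<cdot> bang B ?D) = quote ?y"
  proof -
    interpret G: strict_functor B "stage B C ?D" "fcomp (reindex B (bang B ?D)) F"
      by (rule strict_functor_stage) (use A in simp)
    \<comment> \<open>At this stage \<open>quote ?y\<close> starts at the terminal object, so the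
      \<open>bang\<close> in \<open>fix_incl_lift\<close> is an identity.\<close>
    have "bang (stage B C ?D) (ione C \<cdot> bang B ?D) = iid C \<cdot> (ione C \<cdot> bang B ?D)"
      using G.B.bang_One by simp
    then show ?thesis
      using fix_incl_lift[OF G.strict_functor_axioms, of "quote ?y"] that A
        quote_dom_cod[of ?y ?D] quote_dom_cod[of ?y A]
      by (auto simp: fcomp_def reindex_def in_hom_iff)
  qed
  \<comment> \<open>Self-application is well typed: \<open>\<delta>\<close> ends at
    \<open>omap F ?D\<close>, where \<open>?y\<close> starts.\<close>
  let ?ev = "hom_elt B C (ione C) (omap F A) (ic B C \<delta> ?y)"
  have \<delta>y: "icod C \<cdot> \<delta> = idom C \<cdot> ?y"
    using \<delta> A by simp
  note i = ic_simps[of \<delta> ?y]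
  have ev: "?ev \<in> Ar B" "Dom B ?ev = ?D" "Cod B ?ev = omap \<box> A"
    using hom_elt_simps[of "ione C" "omap F A" "ic B C \<delta> ?y"] i \<delta> \<delta>y A
    by (simp_all add: Box_def fcomp_def gsec_def)
  \<comment> \<open>The arrow \<open>f \<cdot> ?ev\<close> goes from \<open>?D\<close> to
    \<open>A\<close>, so its \<open>F\<close>-image is an element of \<open>?D\<close>; here the
    universal property is used in \<open>B\<close>, through the identity functor.\<close>
  obtain t where t: "t \<in> Ar B" "Dom B t = \<one>" "Cod B t = ?D" "?y \<cdot> t = amap F (f \<cdot> ?ev)"
  proof -
    have "strict_functor B B \<lparr>omap = \<lambda>X. X, amap = \<lambda>g. g\<rparr>"
      by unfold_locales (auto simp: is_functor_def strictly_preserves_finlims_def hom_def)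
    from fix_incl_lift[OF this, of "amap F (f \<cdot> ?ev)"] that show ?thesis
      using f' ev A by auto
  qed
  \<comment> \<open>Both sides factor the same arrow \<open>amap F (amap F (f \<cdot> ?ev))\<close>
    through \<open>amap F ?y\<close>, which is monic in the underlying category of
    \<open>C\<close>.\<close>
  have \<delta>t: "\<delta> \<cdot> t = amap F t"
  proof -
    have G: "strict_functor B (stage B C \<one>) F"
      using functor_F strict_F finlim_B stage_finlim[of \<one>]
      by (simp add: strict_functor_def strict_functor_axioms_def stage_One)
    have "ic B C (\<delta> \<cdot> t) (amap F ?y) = ic B C \<delta> (amap F ?y \<cdot> bang B ?D) \<cdot> t"
      using \<delta>(1-5) t A by (simp add: ic_Cmp)
    also have "\<dots> = quote ?y \<cdot> t"
      by (simp only: \<delta>)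
    also have "\<dots> = amap F (amap F (f \<cdot> ?ev))"
      using t A f' ev by (simp add: quote_Cmp quote_F)
    also have "\<dots> = ic B C (amap F t) (amap F ?y)"
      using t A by (simp add: F_Cmp[symmetric])
    finally have "ic B C (\<delta> \<cdot> t) (amap F ?y) = ic B C (amap F t) (amap F ?y)" .
    then show ?thesis
      using \<delta> t A Cmp_extend[of "idom C" \<delta> "ione C" "bang B ?D" t]
        Cmp_extend[of "icod C" \<delta> "omap F ?D" "bang B ?D" t]
        fix_incl_mono[OF G, of "\<delta> \<cdot> t" "amap F t"]
      by (simp add: in_hom_iff)
  qed
  let ?a = "f \<cdot> (?ev \<cdot> t)"
  \<comment> \<open>At \<open>t\<close>, self-application composes \<open>amap F t\<close> with
    \<open>amap F (f \<cdot> ?ev)\<close>; functoriality makes this \<open>amap F ?a\<close>, so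
    applying \<open>f\<close> returns \<open>?a\<close>.\<close>
  have "?ev \<cdot> t = hom_elt B C (ione C) (omap F A) (ic B C \<delta> ?y \<cdot> t)"
    using i \<delta> \<delta>y t A by (intro hom_elt_Cmp) auto
  also have "ic B C \<delta> ?y \<cdot> t = ic B C (amap F t) (amap F (f \<cdot> ?ev))"
    using \<delta> \<delta>y t A \<delta>t by (simp add: ic_Cmp)
  also have "\<dots> = amap F ?a"
    using t f' ev F_Cmp[of t "f \<cdot> ?ev"] by simp
  finally show ?thesis
    using t f' ev by (intro bexI[of _ ?a]) (auto simp: in_hom_iff)
qed

end

end

theorem theorem5p4:
  fixes B :: "('o, 'm) fcat" and C :: "('o, 'm) ificat"
    and F :: "('o, 'm, 'm, 'm) fctr" and H :: "'m ifctr"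
    and A :: 'o and f :: 'm
  assumes "pregeminal B C F H"
    and "A \<in> Ob B"
    and "f \<in> hom B (omap (Box B C F) A) A"
  shows "\<exists>a \<in> hom B \<one>\<^bsub>B\<^esub> A.
    f \<cdot>\<^bsub>B\<^esub> hom_elt B C (omap F \<one>\<^bsub>B\<^esub>) (omap F A) (amap F a) = a"
  using pregeminal.fixed_point[OF assms] pregeminal.F_One[OF assms(1)] by simp

end
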